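(* Let $k$ be a field of characteristic $0$, let $(\mathfrak g,B)$ be a finite-dimensional quadratic Lie algebra over $k$ with a $\mathbb Z_2$-gradation $\mathfrak g=\mathfrak k\oplus\mathfrak p$ such that $\mathfrak k$ and $\mathfrak p$ are $B$-orthogonal. If $B([\mathfrak p,\mathfrak p],[\mathfrak p,\mathfrak p])\neq\{0\}$, then $$\big(\eta(\nu(\Omega(\mathfrak k)))\big)_4\neq0\quad\text{in } S^4(\mathfrak p\oplus\mathfrak p^* ).$$
   Context: A quadratic Lie algebra $(\mathfrak g,B)$ is a Lie algebra with a nondegenerate invariant symmetric bilinear form $B$. $\mathbb Z_2$-gradation: $[\mathfrak k,\mathfrak k]\subset\mathfrak k$, $[\mathfrak k,\mathfrak p]\subset\mathfrak p$, $[\mathfrak p,\mathfrak p]\subset\mathfrak k$. Casimir element: $\Omega(\mathfrak k)=\sum_k w_kw^k$ for a basis $\{w_k\}$ of $\mathfrak k$ with $B$-dual basis $\{w^k\}$ of $\mathfrak k$. $\omega$ is the symplectic form on $\mathfrak p\oplus\mathfrak p^*$ with $\mathfrak p,\mathfrak p^*$ isotropic and $\omega(\alpha,v)=\alpha(v)$ for $\alpha\in\mathfrak p^*$, $v\in\mathfrak p$. The Weyl algebra $\mathcal W=\mathcal W(\mathfrak p\oplus\mathfrak p^*,\omega)$ is the quotient of $T(\mathfrak p\oplus\mathfrak p^* )$ by the two-sided ideal generated by $v\otimes w-w\otimes v-\omega(v,w)1$. The Lie algebra morphism $\nu:\mathfrak k\to\mathcal W$ is $\nu(x)=\sum_i[x,z_i]z_i^*$,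 with $\{z_i\}$ a basis of $\mathfrak p$ and $\{z_i^*\}$ its dual basis in $\mathfrak p^*$; it is extended to an algebra morphism $U(\mathfrak k)\to\mathcal W$. $\eta:\mathcal W\to S(\mathfrak p\oplus\mathfrak p^* )$ is the linear isomorphism inverse to the symmetrization map $Q(v_1\cdots v_n)=\frac1{n!}\sum_{\sigma\in S_n}v_{\sigma(1)}\cdots v_{\sigma(n)}$, and $(\cdot)_d$ denotes the component in $S^d(\mathfrak p\oplus\mathfrak p^* )$. *)

theory Defs
  imports Complex_Main
    "HOL-Algebra.QuotRing"
    "HOL-Algebra.Module"
    "HOL-Combinatorics.Permutations"
    "HOL-Library.Poly_Mapping"
    "HOL-Library.Function_Algebras"
    "HOL-Library.Product_Plus"
begin

section \<open>Graded quadratic Lie algebras\<close>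

locale lie_algebra = vector_space scale
  for scale :: "'k::field \<Rightarrow> 'g::ab_group_add \<Rightarrow> 'g" +
  fixes br :: "'g \<Rightarrow> 'g \<Rightarrow> 'g"
  assumes br_linear_left: "Vector_Spaces.linear scale scale (\<lambda>x. br x y)"
    and br_linear_right: "Vector_Spaces.linear scale scale (br x)"
    and br_alternating: "br x x = 0"
    and jacobi: "br x (br y z) + br y (br z x) + br z (br x y) = 0"

locale quadratic_lie_algebra = lie_algebra scale br
  for scale :: "'k::field \<Rightarrow> 'g::ab_group_add \<Rightarrow> 'g" and br +
  fixes B :: "'g \<Rightarrow> 'g \<Rightarrow> 'k"
  assumes B_linear_left: "Vector_Spaces.linear scale (*) (\<lambda>x. B x y)"
    and B_linear_right: "Vector_Spaces.linear scale (*) (B x)"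
    and B_sym: "B x y = B y x"
    and B_invariant: "B (br x y) z = B x (br y z)"
    and B_nondegenerate: "(\<And>y. B x y = 0) \<Longrightarrow> x = 0"

locale graded_quadratic_lie_algebra = quadratic_lie_algebra scale br B
  for scale :: "'k::field \<Rightarrow> 'g::ab_group_add \<Rightarrow> 'g" and br B +
  fixes \<kk> \<pp> :: "'g set"
  assumes finite_dim: "\<exists>S. finite S \<and> span S = UNIV"
    and subspace_k: "subspace \<kk>"
    and subspace_p: "subspace \<pp>"
    and direct: "\<kk> \<inter> \<pp> = {0}"
    and total: "\<exists>x\<in>\<kk>. \<exists>y\<in>\<pp>. g = x + y"
    and br_kk: "x \<in> \<kk> \<Longrightarrow> y \<in> \<kk> \<Longrightarrow> br x y \<in> \<kk>"
    and br_kp: "x \<in> \<kk> \<Longrightarrow> y \<in> \<pp> \<Longrightarrow> br x y \<in> \<pp>"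
    and br_pp: "x \<in> \<pp> \<Longrightarrow> y \<in> \<pp> \<Longrightarrow> br x y \<in> \<kk>"
    and orthogonal: "x \<in> \<kk> \<Longrightarrow> y \<in> \<pp> \<Longrightarrow> B x y = 0"

definition is_basis_of ::
  "('k::field \<Rightarrow> 'v::ab_group_add \<Rightarrow> 'v) \<Rightarrow> 'v set \<Rightarrow> 'v set \<Rightarrow> bool" where
  "is_basis_of s X U \<longleftrightarrow> \<not> Modules.module.dependent s X \<and> Modules.module.span s X = U"

definition bracket_space ::
  "('k::field \<Rightarrow> 'g::ab_group_add \<Rightarrow> 'g) \<Rightarrow> ('g \<Rightarrow> 'g \<Rightarrow> 'g) \<Rightarrow> 'g set \<Rightarrow> 'g set \<Rightarrow> 'g set" where
  "bracket_space scale br X Y = Modules.module.span scale {br x y | x y. x \<in> X \<and> y \<in> Y}"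


section \<open>Associative algebras\<close>

text \<open>
  Algebras are records of type \<^type>\<open>module\<close>, which carry both a ring structure and a scalar
  multiplication. Ideals are the two-sided ideals of the ring; they
  are stable under scalars because the algebras are unital.
\<close>

definition alg_quot :: "('k, 'a) module \<Rightarrow> 'a set \<Rightarrow> ('k, 'a set) module" where
  "alg_quot A I =
     \<lparr>carrier = carrier (A Quot I), monoid.mult = monoid.mult (A Quot I), one = one (A Quot I),
      zero = zero (A Quot I), add = add (A Quot I),
      smult = (\<lambda>c X. \<Union>x\<in>X. I +>\<^bsub>A\<^esub> (c \<odot>\<^bsub>A\<^esub> x))\<rparr>"

definition linear_maps :: "('k, 'a) module \<Rightarrow> ('k, 'b) module \<Rightarrow> ('a \<Rightarrow> 'b) set" where
  "linear_maps A C =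
     {f \<in> carrier A \<rightarrow> carrier C.
        (\<forall>a\<in>carrier A. \<forall>b\<in>carrier A. f (a \<oplus>\<^bsub>A\<^esub> b) = f a \<oplus>\<^bsub>C\<^esub> f b) \<and>
        (\<forall>c. \<forall>a\<in>carrier A. f (c \<odot>\<^bsub>A\<^esub> a) = c \<odot>\<^bsub>C\<^esub> f a)}"

definition alg_hom :: "('k, 'a) module \<Rightarrow> ('k, 'b) module \<Rightarrow> ('a \<Rightarrow> 'b) set" where
  "alg_hom A C = ring_hom A C \<inter> linear_maps A C"

definition list_prod :: "('k, 'a) module \<Rightarrow> 'a list \<Rightarrow> 'a" where
  "list_prod A xs = foldr (\<lambda>x y. x \<otimes>\<^bsub>A\<^esub> y) xs \<one>\<^bsub>A\<^esub>"


section \<open>The tensor algebra of a vector space\<close>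

text \<open>Words form a monoid under concatenation, written additively so that the finitely
  supported functions on words are the free associative algebra, with the convolution
  product of \<^type>\<open>poly_mapping\<close>.\<close>

datatype 'v word = Word (letters: "'v list")

instantiation word :: (type) monoid_add
begin
definition zero_word :: "'v word" where
  "zero_word = Word []"
definition plus_word :: "'v word \<Rightarrow> 'v word \<Rightarrow> 'v word" where
  "plus_word u w = Word (letters u @ letters w)"
instance
  by standard (simp_all add: zero_word_def plus_word_def)
end

definition free_alg :: "'v set \<Rightarrow> ('k::field, 'v word \<Rightarrow>\<^sub>0 'k) module" where
  "free_alg V =
     \<lparr>carrier = {f. \<forall>u\<in>Poly_Mapping.keys f. set (letters u) \<subseteq> V},
      monoid.mult = (*), one = 1, zero = 0, add = (+),
      smult = (\<lambda>c f. Poly_Mapping.single 0 c * f)\<rparr>"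

definition free_gen :: "'v \<Rightarrow> ('v word \<Rightarrow>\<^sub>0 'k::field)" where
  "free_gen v = Poly_Mapping.single (Word [v]) 1"

text \<open>The vector space is a subspace \<open>V\<close> of a type with scalar multiplication \<open>s\<close>. Its tensor
  algebra is the free algebra on the set \<open>V\<close> modulo linearity of \<open>v \<mapsto> free_gen v\<close>.\<close>

definition linearity_ideal ::
  "('k::field \<Rightarrow> 'v::ab_group_add \<Rightarrow> 'v) \<Rightarrow> 'v set \<Rightarrow> ('v word \<Rightarrow>\<^sub>0 'k) set" where
  "linearity_ideal s V = Idl\<^bsub>free_alg V\<^esub>
     ({free_gen (v + w) - (free_gen v + free_gen w) | v w. v \<in> V \<and> w \<in> V} \<union>
      {free_gen (s c v) - Poly_Mapping.single 0 c * free_gen v | c v. v \<in> V})"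

definition tensor_alg ::
  "('k::field \<Rightarrow> 'v::ab_group_add \<Rightarrow> 'v) \<Rightarrow> 'v set \<Rightarrow> ('k, ('v word \<Rightarrow>\<^sub>0 'k) set) module" where
  "tensor_alg s V = alg_quot (free_alg V) (linearity_ideal s V)"

definition tensor_gen ::
  "('k::field \<Rightarrow> 'v::ab_group_add \<Rightarrow> 'v) \<Rightarrow> 'v set \<Rightarrow> 'v \<Rightarrow> ('v word \<Rightarrow>\<^sub>0 'k) set" where
  "tensor_gen s V v = linearity_ideal s V +>\<^bsub>free_alg V\<^esub> free_gen v"

definition tensor_power ::
  "('k::field \<Rightarrow> 'v::ab_group_add \<Rightarrow> 'v) \<Rightarrow> 'v set \<Rightarrow> nat \<Rightarrow> ('v word \<Rightarrow>\<^sub>0 'k) set set" where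
  "tensor_power s V d =
     (\<lambda>f. linearity_ideal s V +>\<^bsub>free_alg V\<^esub> f) `
       {f \<in> carrier (free_alg V). \<forall>u\<in>Poly_Mapping.keys f. length (letters u) = d}"


section \<open>The symmetric, Weyl and enveloping algebras\<close>

type_synonym ('k, 'v) tensor_quot = "('k, ('v word \<Rightarrow>\<^sub>0 'k) set set) module"

definition sym_ideal ::
  "('k::field \<Rightarrow> 'v::ab_group_add \<Rightarrow> 'v) \<Rightarrow> 'v set \<Rightarrow> ('v word \<Rightarrow>\<^sub>0 'k) set set" where
  "sym_ideal s V = (let T = tensor_alg s V; i = tensor_gen s V in
     Idl\<^bsub>T\<^esub> {(i v \<otimes>\<^bsub>T\<^esub> i w) \<ominus>\<^bsub>T\<^esub> (i w \<otimes>\<^bsub>T\<^esub> i v) | v w. v \<in> V \<and> w \<in> V})"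

definition sym_alg ::
  "('k::field \<Rightarrow> 'v::ab_group_add \<Rightarrow> 'v) \<Rightarrow> 'v set \<Rightarrow> ('k, 'v) tensor_quot" where
  "sym_alg s V = alg_quot (tensor_alg s V) (sym_ideal s V)"

definition sym_gen ::
  "('k::field \<Rightarrow> 'v::ab_group_add \<Rightarrow> 'v) \<Rightarrow> 'v set \<Rightarrow> 'v \<Rightarrow> ('v word \<Rightarrow>\<^sub>0 'k) set set" where
  "sym_gen s V v = sym_ideal s V +>\<^bsub>tensor_alg s V\<^esub> tensor_gen s V v"

definition sym_power ::
  "('k::field \<Rightarrow> 'v::ab_group_add \<Rightarrow> 'v) \<Rightarrow> 'v set \<Rightarrow> nat \<Rightarrow> ('v word \<Rightarrow>\<^sub>0 'k) set set set" where
  "sym_power s V d = (\<lambda>t. sym_ideal s V +>\<^bsub>tensor_alg s V\<^esub> t) ` tensor_power s V d"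

definition sym_component ::
  "('k::field \<Rightarrow> 'v::ab_group_add \<Rightarrow> 'v) \<Rightarrow> 'v set \<Rightarrow> nat
     \<Rightarrow> ('v word \<Rightarrow>\<^sub>0 'k) set set \<Rightarrow> ('v word \<Rightarrow>\<^sub>0 'k) set set" where
  "sym_component s V d a = (let S = sym_alg s V in
     THE x. \<exists>c n. (\<forall>i. c i \<in> sym_power s V i) \<and> (\<forall>i>n. c i = \<zero>\<^bsub>S\<^esub>) \<and>
                  a = (\<Oplus>\<^bsub>S\<^esub>i\<in>{..n}. c i) \<and> x = c d)"

definition weyl_ideal ::
  "('k::field \<Rightarrow> 'v::ab_group_add \<Rightarrow> 'v) \<Rightarrow> 'v set \<Rightarrow> ('v \<Rightarrow> 'v \<Rightarrow> 'k)
     \<Rightarrow> ('v word \<Rightarrow>\<^sub>0 'k) set set" where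
  "weyl_ideal s V \<omega> = (let T = tensor_alg s V; i = tensor_gen s V in
     Idl\<^bsub>T\<^esub> {(i v \<otimes>\<^bsub>T\<^esub> i w) \<ominus>\<^bsub>T\<^esub> (i w \<otimes>\<^bsub>T\<^esub> i v) \<ominus>\<^bsub>T\<^esub> (\<omega> v w \<odot>\<^bsub>T\<^esub> \<one>\<^bsub>T\<^esub>)
          | v w. v \<in> V \<and> w \<in> V})"

definition weyl_alg ::
  "('k::field \<Rightarrow> 'v::ab_group_add \<Rightarrow> 'v) \<Rightarrow> 'v set \<Rightarrow> ('v \<Rightarrow> 'v \<Rightarrow> 'k)
     \<Rightarrow> ('k, 'v) tensor_quot" where
  "weyl_alg s V \<omega> = alg_quot (tensor_alg s V) (weyl_ideal s V \<omega>)"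

definition weyl_gen ::
  "('k::field \<Rightarrow> 'v::ab_group_add \<Rightarrow> 'v) \<Rightarrow> 'v set \<Rightarrow> ('v \<Rightarrow> 'v \<Rightarrow> 'k)
     \<Rightarrow> 'v \<Rightarrow> ('v word \<Rightarrow>\<^sub>0 'k) set set" where
  "weyl_gen s V \<omega> v = weyl_ideal s V \<omega> +>\<^bsub>tensor_alg s V\<^esub> tensor_gen s V v"

definition env_ideal ::
  "('k::field \<Rightarrow> 'g::ab_group_add \<Rightarrow> 'g) \<Rightarrow> ('g \<Rightarrow> 'g \<Rightarrow> 'g) \<Rightarrow> 'g set
     \<Rightarrow> ('g word \<Rightarrow>\<^sub>0 'k) set set" where
  "env_ideal s br L = (let T = tensor_alg s L; i = tensor_gen s L in
     Idl\<^bsub>T\<^esub> {(i x \<otimes>\<^bsub>T\<^esub> i y) \<ominus>\<^bsub>T\<^esub> (i y \<otimes>\<^bsub>T\<^esub> i x) \<ominus>\<^bsub>T\<^esub> i (br x y) | x y. x \<in> L \<and> y \<in> L})"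

definition env_alg ::
  "('k::field \<Rightarrow> 'g::ab_group_add \<Rightarrow> 'g) \<Rightarrow> ('g \<Rightarrow> 'g \<Rightarrow> 'g) \<Rightarrow> 'g set
     \<Rightarrow> ('k, 'g) tensor_quot" where
  "env_alg s br L = alg_quot (tensor_alg s L) (env_ideal s br L)"

definition env_gen ::
  "('k::field \<Rightarrow> 'g::ab_group_add \<Rightarrow> 'g) \<Rightarrow> ('g \<Rightarrow> 'g \<Rightarrow> 'g) \<Rightarrow> 'g set
     \<Rightarrow> 'g \<Rightarrow> ('g word \<Rightarrow>\<^sub>0 'k) set set" where
  "env_gen s br L x = env_ideal s br L +>\<^bsub>tensor_alg s L\<^esub> tensor_gen s L x"


section \<open>Symmetrization\<close>

text \<open>\<open>symmetrization\<close> and \<open>nu\<close> below are the linear map, respectively the algebra morphism,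
  determined on its carrier by its values on products of generators, respectively on
  generators.\<close>

definition symmetrization ::
  "('k::field_char_0 \<Rightarrow> 'v::ab_group_add \<Rightarrow> 'v) \<Rightarrow> 'v set \<Rightarrow> ('v \<Rightarrow> 'v \<Rightarrow> 'k)
     \<Rightarrow> ('v word \<Rightarrow>\<^sub>0 'k) set set \<Rightarrow> ('v word \<Rightarrow>\<^sub>0 'k) set set" where
  "symmetrization s V \<omega> = (let S = sym_alg s V; W = weyl_alg s V \<omega> in
     SOME Q. Q \<in> linear_maps S W \<and>
       (\<forall>vs. set vs \<subseteq> V \<longrightarrow>
          Q (list_prod S (map (sym_gen s V) vs)) =
            inverse (fact (length vs)) \<odot>\<^bsub>W\<^esub>
              (\<Oplus>\<^bsub>W\<^esub>\<sigma>\<in>{\<sigma>. \<sigma> permutes {..<length vs}}.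
                 list_prod W (map (\<lambda>i. weyl_gen s V \<omega> (vs ! \<sigma> i)) [0..<length vs]))))"

definition eta ::
  "('k::field_char_0 \<Rightarrow> 'v::ab_group_add \<Rightarrow> 'v) \<Rightarrow> 'v set \<Rightarrow> ('v \<Rightarrow> 'v \<Rightarrow> 'k)
     \<Rightarrow> ('v word \<Rightarrow>\<^sub>0 'k) set set \<Rightarrow> ('v word \<Rightarrow>\<^sub>0 'k) set set" where
  "eta s V \<omega> = inv_into (carrier (sym_alg s V)) (symmetrization s V \<omega>)"


section \<open>The symplectic space \<open>\<pp> \<oplus> \<pp>\<^sup>*\<close>, the Casimir element and the morphism \<open>\<nu>\<close>\<close>

text \<open>A functional on the subspace \<open>\<pp>\<close> is represented by its extension by zero off \<open>\<pp>\<close>.\<close>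

definition dual_space ::
  "('k::field \<Rightarrow> 'g::ab_group_add \<Rightarrow> 'g) \<Rightarrow> 'g set \<Rightarrow> ('g \<Rightarrow> 'k) set" where
  "dual_space scale \<pp> =
     {\<alpha>. (\<forall>x\<in>\<pp>. \<forall>y\<in>\<pp>. \<alpha> (x + y) = \<alpha> x + \<alpha> y) \<and>
         (\<forall>c. \<forall>x\<in>\<pp>. \<alpha> (scale c x) = c * \<alpha> x) \<and>
         (\<forall>x. x \<notin> \<pp> \<longrightarrow> \<alpha> x = 0)}"

definition symp_space ::
  "('k::field \<Rightarrow> 'g::ab_group_add \<Rightarrow> 'g) \<Rightarrow> 'g set \<Rightarrow> ('g \<times> ('g \<Rightarrow> 'k)) set" where
  "symp_space scale \<pp> = \<pp> \<times> dual_space scale \<pp>"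

definition symp_scale ::
  "('k::field \<Rightarrow> 'g \<Rightarrow> 'g) \<Rightarrow> 'k \<Rightarrow> 'g \<times> ('g \<Rightarrow> 'k) \<Rightarrow> 'g \<times> ('g \<Rightarrow> 'k)" where
  "symp_scale scale c = (\<lambda>(v, \<alpha>). (scale c v, \<lambda>x. c * \<alpha> x))"

definition symp_form :: "'g \<times> ('g \<Rightarrow> 'k::field) \<Rightarrow> 'g \<times> ('g \<Rightarrow> 'k) \<Rightarrow> 'k" where
  "symp_form = (\<lambda>(v, \<alpha>) (w, \<beta>). \<alpha> w - \<beta> v)"

definition dual_basis ::
  "('k::field \<Rightarrow> 'g::ab_group_add \<Rightarrow> 'g) \<Rightarrow> 'g set \<Rightarrow> 'g set \<Rightarrow> 'g \<Rightarrow> ('g \<Rightarrow> 'k)" where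
  "dual_basis scale \<pp> Z z =
     (THE \<alpha>. \<alpha> \<in> dual_space scale \<pp> \<and> (\<forall>z'\<in>Z. \<alpha> z' = (if z' = z then 1 else 0)))"

definition B_dual_basis ::
  "('g \<Rightarrow> 'g \<Rightarrow> 'k::field) \<Rightarrow> 'g set \<Rightarrow> 'g set \<Rightarrow> 'g \<Rightarrow> 'g" where
  "B_dual_basis B \<kk> X w =
     (THE y. y \<in> \<kk> \<and> (\<forall>w'\<in>X. B w' y = (if w' = w then 1 else 0)))"

definition casimir ::
  "('k::field \<Rightarrow> 'g::ab_group_add \<Rightarrow> 'g) \<Rightarrow> ('g \<Rightarrow> 'g \<Rightarrow> 'g) \<Rightarrow> ('g \<Rightarrow> 'g \<Rightarrow> 'k)
     \<Rightarrow> 'g set \<Rightarrow> 'g set \<Rightarrow> ('g word \<Rightarrow>\<^sub>0 'k) set set" where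
  "casimir scale br B \<kk> X = (let U = env_alg scale br \<kk> in
     \<Oplus>\<^bsub>U\<^esub>w\<in>X. env_gen scale br \<kk> w \<otimes>\<^bsub>U\<^esub> env_gen scale br \<kk> (B_dual_basis B \<kk> X w))"

abbreviation weyl_p ::
  "('k::field \<Rightarrow> 'g::ab_group_add \<Rightarrow> 'g) \<Rightarrow> 'g set \<Rightarrow> ('k, 'g \<times> ('g \<Rightarrow> 'k)) tensor_quot" where
  "weyl_p scale \<pp> \<equiv> weyl_alg (symp_scale scale) (symp_space scale \<pp>) symp_form"

definition nu_lie ::
  "('k::field \<Rightarrow> 'g::ab_group_add \<Rightarrow> 'g) \<Rightarrow> ('g \<Rightarrow> 'g \<Rightarrow> 'g) \<Rightarrow> 'g set \<Rightarrow> 'g set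
     \<Rightarrow> 'g \<Rightarrow> (('g \<times> ('g \<Rightarrow> 'k)) word \<Rightarrow>\<^sub>0 'k) set set" where
  "nu_lie scale br \<pp> Z x =
     (let W = weyl_p scale \<pp>;
          i = weyl_gen (symp_scale scale) (symp_space scale \<pp>) symp_form in
      \<Oplus>\<^bsub>W\<^esub>z\<in>Z. i (br x z, 0) \<otimes>\<^bsub>W\<^esub> i (0, dual_basis scale \<pp> Z z))"

definition nu ::
  "('k::field \<Rightarrow> 'g::ab_group_add \<Rightarrow> 'g) \<Rightarrow> ('g \<Rightarrow> 'g \<Rightarrow> 'g) \<Rightarrow> 'g set \<Rightarrow> 'g set \<Rightarrow> 'g set
     \<Rightarrow> ('g word \<Rightarrow>\<^sub>0 'k) set set \<Rightarrow> (('g \<times> ('g \<Rightarrow> 'k)) word \<Rightarrow>\<^sub>0 'k) set set" where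
  "nu scale br \<kk> \<pp> Z =
     (SOME \<phi>. \<phi> \<in> alg_hom (env_alg scale br \<kk>) (weyl_p scale \<pp>) \<and>
        (\<forall>x\<in>\<kk>. \<phi> (env_gen scale br \<kk> x) = nu_lie scale br \<pp> Z x))"

end

theory Submission
  imports Defs
begin

text \<open>
  Every algebra involved is a quotient of the free algebra on words. The leading term of
  \<open>\<nu>(\<Omega>(\<kk>))\<close> is \<open>\<Sum>\<^sub>w N(w) N(w\<^sup>*)\<close>, where \<open>N(x) = \<Sum>\<^sub>i [x,z\<^sub>i] z\<^sub>i\<^sup>*\<close>. As a polynomial function it
  takes the value \<open>B([u,v],[u,v])\<close> at the point determined by \<open>u,v \<in> \<pp>\<close>, and some such value is
  nonzero because \<open>B([u,v],[w,t])\<close> has the symmetries of a curvature tensor. To read off the degree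
  4 component of \<open>\<eta>\<close> one evaluates a word by Wick's formula (sum over partial pairings of its
  letters). The resulting functional is compatible with the Weyl relations, vanishes on
  symmetrized words of length different from 4, and on words of length 4 is the evaluation of
  the leading term.
\<close>


section \<open>The free algebra and its two-sided ideals\<close>

text \<open>The obstacle is that an element of a quotient by relations carries no coordinates that
  would show it to be nonzero. It is therefore detected by a linear functional that kills the
  relations. This suits the choice made by \<open>eta\<close>: any preimage of
  \<nu>(\<Omega>(\<kk>)) under symmetrization gives the functional the same value, so what must be
  supplied is that a preimage exists and that the \<open>THE\<close> in \<open>sym_component\<close>
  is unambiguous, the latter because the relations of the symmetric algebra are homogeneous. The
  weight \<omega> / 2 of a pair comes from splitting a product in the Weyl algebra into its
  symmetric part and half its commutator: v w = (v w + w v) / 2 + \<omega>(v,w) / 2. Since the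
  algebras are cosets of cosets, all computations take place on representatives, which are
  noncommutative polynomials; equality becomes membership in a single ideal spanned by
  relations.\<close>

abbreviation free_carrier :: "'v set \<Rightarrow> ('v word \<Rightarrow>\<^sub>0 'k::field) set" where
  "free_carrier V \<equiv> carrier (free_alg V)"

abbreviation scal :: "'k::field \<Rightarrow> ('v word \<Rightarrow>\<^sub>0 'k)" where
  "scal c \<equiv> Poly_Mapping.single 0 c"

section \<open>Words, constants and the carrier of the free algebra\<close>

definition wd :: "'v list \<Rightarrow> ('v word \<Rightarrow>\<^sub>0 'k::field)" where
  "wd us = Poly_Mapping.single (Word us) 1"

lemma free_gen_eq_wd: "free_gen v = wd [v]"
  by (simp add: free_gen_def wd_def)

lemma wd_Nil: "wd [] = 1"
  by (simp add: wd_def flip: zero_word_def)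

lemma wd_append: "wd (us @ ws) = wd us * wd ws"
  by (simp add: wd_def mult_single plus_word_def)

lemma wd_Cons: "wd (u # ws) = wd [u] * wd ws"
  using wd_append[of "[u]" ws] by simp

lemma scal_wd: "scal c * wd us = Poly_Mapping.single (Word us) c"
  by (simp add: wd_def mult_single)

lemma scal_mult: "scal (a * b) = scal a * scal b"
  by (simp add: mult_single)

lemma mem_free_carrier: "f \<in> free_carrier V \<longleftrightarrow> (\<forall>u\<in>Poly_Mapping.keys f. set (letters u) \<subseteq> V)"
  by (simp add: free_alg_def)

lemma zero_in_free [simp]: "0 \<in> free_carrier V"
  by (simp add: mem_free_carrier)

lemma one_in_free [simp]: "1 \<in> free_carrier V"
  by (simp add: mem_free_carrier zero_word_def)

lemma scal_in_free [simp]: "scal c \<in> free_carrier V"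
  by (simp add: mem_free_carrier zero_word_def)

lemma wd_in_free [simp]: "set us \<subseteq> V \<Longrightarrow> wd us \<in> free_carrier V"
  by (simp add: mem_free_carrier wd_def)

lemma add_in_free [simp]: "f \<in> free_carrier V \<Longrightarrow> g \<in> free_carrier V \<Longrightarrow> f + g \<in> free_carrier V"
  using Poly_Mapping.keys_add[of f g] by (auto simp: mem_free_carrier)

lemma uminus_in_free [simp]: "f \<in> free_carrier V \<Longrightarrow> - f \<in> free_carrier V"
  by (simp add: mem_free_carrier)

lemma diff_in_free [simp]: "f \<in> free_carrier V \<Longrightarrow> g \<in> free_carrier V \<Longrightarrow> f - g \<in> free_carrier V"
  using add_in_free[of f V "- g"] by simp

lemma mult_in_free [simp]: "f \<in> free_carrier V \<Longrightarrow> g \<in> free_carrier V \<Longrightarrow> f * g \<in> free_carrier V"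
proof -
  assume "f \<in> free_carrier V" "g \<in> free_carrier V"
  moreover have "letters (a + b) = letters a @ letters b" for a b :: "'a word"
    by (simp add: plus_word_def)
  ultimately show ?thesis
    using Poly_Mapping.keys_mult[of f g] unfolding mem_free_carrier by (auto 0 3 dest!: subsetD)
qed

lemma sum_in_free [simp]: "(\<And>i. i \<in> I \<Longrightarrow> f i \<in> free_carrier V) \<Longrightarrow> sum f I \<in> free_carrier V"
  by (induction I rule: infinite_finite_induct) auto

lemma prod_list_in_free:
  "(\<And>f. f \<in> set fs \<Longrightarrow> f \<in> free_carrier V) \<Longrightarrow> prod_list fs \<in> free_carrier V"
  by (induction fs) auto

text \<open>Removing one key from the support leaves a smaller polynomial over the same alphabet, so
  linear statements reduce to single words.\<close>

lemma free_induct [consumes 1, case_names zero step]: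
  assumes "f \<in> free_carrier V" and "P 0"
    and step: "\<And>c us f. set us \<subseteq> V \<Longrightarrow> f \<in> free_carrier V \<Longrightarrow> P f \<Longrightarrow> P (scal c * wd us + f)"
  shows "P f"
  using assms(1)
proof (induction "card (Poly_Mapping.keys f)" arbitrary: f)
  case 0
  then show ?case using \<open>P 0\<close> by simp
next
  case (Suc n)
  then obtain u where u: "u \<in> Poly_Mapping.keys f"
    by (metis card.empty ex_in_conv nat.distinct(1))
  define g where "g = f - Poly_Mapping.single u (Poly_Mapping.lookup f u)"
  have kg: "Poly_Mapping.keys g = Poly_Mapping.keys f - {u}"
    by (auto simp: g_def in_keys_iff lookup_minus lookup_single when_def split: if_splits)
  have g: "g \<in> free_carrier V" using Suc.prems kg by (auto simp: mem_free_carrier)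
  have "P g" using Suc.hyps(1)[OF _ g] Suc.hyps(2) kg u by simp
  moreover have "f = scal (Poly_Mapping.lookup f u) * wd (letters u) + g"
    by (simp add: g_def scal_wd)
  ultimately show ?case
    using step[of "letters u" g "Poly_Mapping.lookup f u"] g Suc.prems u by (auto simp: mem_free_carrier)
qed

text \<open>Opens \<open>free_induct\<close> to arbitrary elements, with the whole type as
  alphabet.\<close>

lemma in_free_UNIV: "f \<in> free_carrier UNIV"
  by (simp add: mem_free_carrier)

lemma scal_commute: "scal c * f = f * scal c"
proof (induction rule: free_induct[OF in_free_UNIV[of f]])
  case 1
  then show ?case by simp
next
  case (2 a us f)
  then show ?case by (simp add: distrib_left distrib_right scal_wd mult_single mult.commute)
qed

lemma scal_left_commute: "f * (scal c * g) = scal c * (f * g)"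
  by (metis mult.assoc scal_commute)

text \<open>The target is again a free algebra, over any alphabet, so that \<open>symz\<close>,
  \<open>hom_part\<close> and \<open>nu_ext\<close> are all instances; a scalar functional such as
  \<open>wick_ext\<close> takes its values among the constants \<open>scal c\<close>.\<close>

definition lext :: "('v list \<Rightarrow> ('w word \<Rightarrow>\<^sub>0 'k::field)) \<Rightarrow> ('v word \<Rightarrow>\<^sub>0 'k) \<Rightarrow> ('w word \<Rightarrow>\<^sub>0 'k)" where
  "lext h f = (\<Sum>u\<in>Poly_Mapping.keys f. scal (Poly_Mapping.lookup f u) * h (letters u))"

lemma lext_superset:
  "finite A \<Longrightarrow> Poly_Mapping.keys f \<subseteq> A \<Longrightarrow> lext h f = (\<Sum>u\<in>A. scal (Poly_Mapping.lookup f u) * h (letters u))"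
  unfolding lext_def by (rule sum.mono_neutral_left) (auto simp: in_keys_iff)

lemma lext_zero [simp]: "lext h 0 = 0"
  by (simp add: lext_def)

lemma lext_add: "lext h (f + g) = lext h f + lext h g"
  by (subst (1 2 3) lext_superset[of "Poly_Mapping.keys f \<union> Poly_Mapping.keys g"])
     (use Poly_Mapping.keys_add[of f g] in \<open>auto simp: lookup_add single_add distrib_right sum.distrib\<close>)

lemma lext_uminus: "lext h (- f) = - lext h f"
  by (metis add_eq_0_iff lext_add lext_zero right_minus)

lemma lext_diff: "lext h (f - g) = lext h f - lext h g"
  by (metis add_uminus_conv_diff lext_add lext_uminus)

lemma lext_sum: "lext h (sum f I) = (\<Sum>i\<in>I. lext h (f i))"
  by (induction I rule: infinite_finite_induct) (auto simp: lext_add)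

lemma lext_scal_wd: "lext h (scal c * wd us) = scal c * h us"
  by (subst scal_wd, subst lext_superset[of "{Word us}"]) auto

lemma lext_wd [simp]: "lext h (wd us) = h us"
  using lext_scal_wd[of h 1 us] by simp

lemma lext_scal: "lext h (scal c * f) = scal c * lext h f"
proof (induction rule: free_induct[OF in_free_UNIV[of f]])
  case 1
  then show ?case by simp
next
  case (2 a us f)
  have "lext h (scal c * (scal a * wd us)) = scal c * (scal a * h us)"
    by (simp add: lext_scal_wd flip: mult.assoc scal_mult)
  then show ?case by (simp add: distrib_left lext_add lext_scal_wd 2)
qed

lemma lext_in_free:
  assumes "f \<in> free_carrier V" "\<And>us. set us \<subseteq> V \<Longrightarrow> h us \<in> free_carrier V'"
  shows "lext h f \<in> free_carrier V'"
  using assms by (auto simp: lext_def mem_free_carrier[of f])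

text \<open>The two-sided ideal generated by \<open>R\<close>, built from its spanning elements c u
  r w with words u and w. The induction rule lets a linear map be tested on these elements alone;
  closure under multiplication by polynomials is derived below.\<close>

inductive_set tideal :: "'v set \<Rightarrow> ('v word \<Rightarrow>\<^sub>0 'k::field) set \<Rightarrow> ('v word \<Rightarrow>\<^sub>0 'k) set"
  for V R where
  zero: "0 \<in> tideal V R"
| step: "f \<in> tideal V R \<Longrightarrow> set us \<subseteq> V \<Longrightarrow> set ws \<subseteq> V \<Longrightarrow> r \<in> R
    \<Longrightarrow> scal c * (wd us * r * wd ws) + f \<in> tideal V R"

lemma tideal_add: "f \<in> tideal V R \<Longrightarrow> g \<in> tideal V R \<Longrightarrow> f + g \<in> tideal V R"
  by (induction rule: tideal.induct) (auto simp: add.assoc intro: tideal.step)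

lemma tideal_gen: "set us \<subseteq> V \<Longrightarrow> set ws \<subseteq> V \<Longrightarrow> r \<in> R \<Longrightarrow> scal c * (wd us * r * wd ws) \<in> tideal V R"
  using tideal.step[OF tideal.zero, of us V ws r R c] by simp

lemma tideal_word: "set us \<subseteq> V \<Longrightarrow> set ws \<subseteq> V \<Longrightarrow> r \<in> R \<Longrightarrow> wd us * r * wd ws \<in> tideal V R"
  using tideal_gen[of us V ws r R 1] by simp

lemma tideal_incl: "r \<in> R \<Longrightarrow> r \<in> tideal V R"
  using tideal_word[of "[]" V "[]" r R] by (simp add: wd_Nil)

lemma tideal_scal: "f \<in> tideal V R \<Longrightarrow> scal c * f \<in> tideal V R"
  by (induction rule: tideal.induct)
     (auto simp: distrib_left tideal.zero simp flip: mult.assoc scal_mult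
       intro!: tideal_add tideal_gen[unfolded mult.assoc[symmetric]])

lemma tideal_uminus: "f \<in> tideal V R \<Longrightarrow> - f \<in> tideal V R"
  using tideal_scal[of f V R "- 1"] by (simp add: single_uminus)

lemma tideal_diff: "f \<in> tideal V R \<Longrightarrow> g \<in> tideal V R \<Longrightarrow> f - g \<in> tideal V R"
  using tideal_add[of f V R "- g"] tideal_uminus by auto

lemma tideal_sum: "(\<And>i. i \<in> I \<Longrightarrow> f i \<in> tideal V R) \<Longrightarrow> sum f I \<in> tideal V R"
  by (induction I rule: infinite_finite_induct) (auto intro: tideal_add tideal.zero)

lemma tideal_wd_left: "f \<in> tideal V R \<Longrightarrow> set us \<subseteq> V \<Longrightarrow> wd us * f \<in> tideal V R"
proof (induction rule: tideal.induct)
  case zero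
  then show ?case by (simp add: tideal.zero)
next
  case (step f us' ws r c)
  have "wd us * (scal c * (wd us' * r * wd ws)) = scal c * (wd (us @ us') * r * wd ws)"
    by (simp only: scal_left_commute wd_append mult.assoc)
  then show ?case using step by (auto simp: distrib_left intro!: tideal_add tideal_gen)
qed

lemma tideal_wd_right: "f \<in> tideal V R \<Longrightarrow> set us \<subseteq> V \<Longrightarrow> f * wd us \<in> tideal V R"
proof (induction rule: tideal.induct)
  case zero
  then show ?case by (simp add: tideal.zero)
next
  case (step f us' ws r c)
  have "scal c * (wd us' * r * wd ws) * wd us = scal c * (wd us' * r * wd (ws @ us))"
    by (simp only: wd_append mult.assoc)
  then show ?case using step by (auto simp: distrib_right intro!: tideal_add tideal_gen)
qed

lemma tideal_left: "g \<in> free_carrier V \<Longrightarrow> f \<in> tideal V R \<Longrightarrow> g * f \<in> tideal V R"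
  by (induction rule: free_induct)
     (auto simp: distrib_right mult.assoc tideal.zero intro!: tideal_add tideal_scal tideal_wd_left)

lemma tideal_right: "g \<in> free_carrier V \<Longrightarrow> f \<in> tideal V R \<Longrightarrow> f * g \<in> tideal V R"
  by (induction rule: free_induct)
     (auto simp: distrib_left scal_left_commute tideal.zero intro!: tideal_add tideal_scal tideal_wd_right)

lemma tideal_subset:
  assumes "f \<in> tideal V R" "R \<subseteq> free_carrier V"
  shows "f \<in> free_carrier V"
  using assms by (induction rule: tideal.induct) auto

lemma tideal_mono: "f \<in> tideal V R \<Longrightarrow> R \<subseteq> tideal V R' \<Longrightarrow> f \<in> tideal V R'"
  by (induction rule: tideal.induct)
     (auto intro!: tideal.zero tideal_add tideal_scal tideal_wd_left tideal_wd_right)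

text \<open>The criterion by which \<open>symz\<close>, \<open>hom_part\<close> and
  \<open>nu_ext\<close> are seen to respect relations.\<close>

lemma lext_tideal:
  assumes "f \<in> tideal V R"
    and "\<And>us ws r. set us \<subseteq> V \<Longrightarrow> set ws \<subseteq> V \<Longrightarrow> r \<in> R \<Longrightarrow> lext h (wd us * r * wd ws) \<in> tideal V' R'"
  shows "lext h f \<in> tideal V' R'"
  using assms(1)
  by (induction rule: tideal.induct)
     (auto simp: lext_add lext_scal intro!: tideal.zero tideal_add tideal_scal assms(2))

lemma free_alg_sel:
  "x \<otimes>\<^bsub>free_alg V\<^esub> y = x * y" "x \<oplus>\<^bsub>free_alg V\<^esub> y = x + y" "\<one>\<^bsub>free_alg V\<^esub> = 1" "\<zero>\<^bsub>free_alg V\<^esub> = 0"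
  "c \<odot>\<^bsub>free_alg V\<^esub> x = scal c * x"
  by (simp_all add: free_alg_def)

section \<open>Presented algebras\<close>

text \<open>A surjection from the free algebra with kernel \<open>J\<close>, stated so that
  \<open>A\<close> can be handled through representatives whatever its elements are.\<close>

locale presentation =
  fixes V :: "'v set" and J :: "('v word \<Rightarrow>\<^sub>0 'k::field) set"
    and A :: "('k, 'a) module" and q :: "('v word \<Rightarrow>\<^sub>0 'k) \<Rightarrow> 'a"
  assumes onto: "q ` free_carrier V = carrier A"
    and ker: "f \<in> free_carrier V \<Longrightarrow> g \<in> free_carrier V \<Longrightarrow> q f = q g \<longleftrightarrow> f - g \<in> J"
    and q_add: "f \<in> free_carrier V \<Longrightarrow> g \<in> free_carrier V \<Longrightarrow> q (f + g) = q f \<oplus>\<^bsub>A\<^esub> q g"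
    and q_mult: "f \<in> free_carrier V \<Longrightarrow> g \<in> free_carrier V \<Longrightarrow> q (f * g) = q f \<otimes>\<^bsub>A\<^esub> q g"
    and q_one: "q 1 = \<one>\<^bsub>A\<^esub>"
    and q_zero: "q 0 = \<zero>\<^bsub>A\<^esub>"
    and q_smult: "f \<in> free_carrier V \<Longrightarrow> q (scal c * f) = c \<odot>\<^bsub>A\<^esub> q f"
begin

lemma q_in [simp]: "f \<in> free_carrier V \<Longrightarrow> q f \<in> carrier A"
  using onto by auto

lemma carrierE:
  assumes "a \<in> carrier A"
  obtains f where "f \<in> free_carrier V" "a = q f"
  using assms onto by auto

lemma ring_A: "ring A"
proof (rule ringI)
  show "abelian_group A"
  proof (rule abelian_groupI)
    fix x assume "x \<in> carrier A"
    then obtain f where f: "f \<in> free_carrier V" "x = q f" by (rule carrierE)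
    then show "\<exists>y\<in>carrier A. y \<oplus>\<^bsub>A\<^esub> x = \<zero>\<^bsub>A\<^esub>"
      by (intro bexI[of _ "q (- f)"]) (auto simp flip: q_add q_zero)
    show "\<zero>\<^bsub>A\<^esub> \<oplus>\<^bsub>A\<^esub> x = x"
      using f by (simp flip: q_add q_zero)
  qed (auto elim!: carrierE simp: add_ac simp flip: q_add q_zero)
  show "Group.monoid A"
    by (rule monoidI) (auto elim!: carrierE simp: mult.assoc simp flip: q_mult q_one)
qed (auto elim!: carrierE simp: distrib_left distrib_right simp flip: q_mult q_add)

lemma q_uminus: "f \<in> free_carrier V \<Longrightarrow> q (- f) = \<ominus>\<^bsub>A\<^esub> q f"
proof -
  interpret ring A by (rule ring_A)
  assume f: "f \<in> free_carrier V"
  then have "q (- f) \<oplus>\<^bsub>A\<^esub> q f = \<zero>\<^bsub>A\<^esub>"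
    by (simp flip: q_add q_zero)
  then show ?thesis using f by (simp add: minus_equality)
qed

lemma q_diff: "f \<in> free_carrier V \<Longrightarrow> g \<in> free_carrier V \<Longrightarrow> q (f - g) = q f \<ominus>\<^bsub>A\<^esub> q g"
  using q_add[of f "- g"] by (simp add: q_uminus a_minus_def)

lemma q_sum:
  assumes "finite I" "\<And>i. i \<in> I \<Longrightarrow> f i \<in> free_carrier V"
  shows "q (sum f I) = (\<Oplus>\<^bsub>A\<^esub>i\<in>I. q (f i))"
proof -
  interpret ring A by (rule ring_A)
  show ?thesis using assms
  proof (induction I rule: finite_induct)
    case (insert i I)
    then have "(\<Oplus>\<^bsub>A\<^esub>i\<in>insert i I. q (f i)) = q (f i) \<oplus>\<^bsub>A\<^esub> (\<Oplus>\<^bsub>A\<^esub>i\<in>I. q (f i))"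
      by (intro finsum_insert) auto
    with insert show ?case by (simp add: q_add)
  qed (simp add: q_zero)
qed

lemma q_wd:
  "set us \<subseteq> V \<Longrightarrow> q (wd us) = list_prod A (map (\<lambda>v. q (wd [v])) us)"
proof (induction us)
  case (Cons u us)
  then have "q (wd (u # us)) = q (wd [u]) \<otimes>\<^bsub>A\<^esub> q (wd us)"
    by (subst wd_Cons) (simp add: q_mult)
  with Cons show ?case by (simp add: list_prod_def)
qed (simp add: list_prod_def wd_Nil q_one)

lemma linear_maps_eqI:
  assumes "\<phi> \<in> linear_maps A C" "\<psi> \<in> linear_maps A C"
    and "\<And>us. set us \<subseteq> V \<Longrightarrow> \<phi> (q (wd us)) = \<psi> (q (wd us))"
    and "f \<in> free_carrier V"
  shows "\<phi> (q f) = \<psi> (q f)"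
  using assms(4)
proof (induction rule: free_induct)
  case zero
  \<comment> \<open>Membership in \<open>linear_maps\<close> says nothing about zero directly;
    writing zero as 0 times the class of the empty word brings it under the scaling
    condition.\<close>
  have "\<zero>\<^bsub>A\<^esub> = 0 \<odot>\<^bsub>A\<^esub> q (wd [])"
    using q_smult[of "wd []" 0] by (simp add: q_zero)
  then show ?case using assms(1,2) assms(3)[of "[]"] by (auto simp: linear_maps_def q_zero)
next
  case (step c us f)
  then have "c \<odot>\<^bsub>A\<^esub> q (wd us) \<in> carrier A" by (simp flip: q_smult)
  with step show ?case using assms(1,2) assms(3)[of us]
    by (auto simp: linear_maps_def q_add q_smult)
qed

end

lemma presentation_free:
  "presentation V (tideal V {}) (free_alg V :: ('k::field, 'v word \<Rightarrow>\<^sub>0 'k) module) (\<lambda>f. f)"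
proof -
  have "tideal V {} = ({0} :: ('v word \<Rightarrow>\<^sub>0 'k) set)"
    by (auto intro: tideal.zero elim: tideal.cases)
  then show ?thesis by (intro presentation.intro) (simp_all add: free_alg_sel)
qed

text \<open>Quotients compose: dividing a presented algebra by the ideal generated by the classes of
  \<open>R\<close> just adds \<open>R\<close> to the relations. It is used once for the linearity
  relations and once more for the commutation relations. The core is that \<open>I\<close> and the
  image of \<open>?K\<close> under \<open>q\<close> coincide.\<close>

lemma presentation_quot:
  assumes "presentation V (tideal V R0) A q" and R0: "R0 \<subseteq> free_carrier V" and R: "R \<subseteq> free_carrier V"
  shows "presentation V (tideal V (R0 \<union> R)) (alg_quot A (Idl\<^bsub>A\<^esub> (q ` R)))
           (\<lambda>f. (Idl\<^bsub>A\<^esub> (q ` R)) +>\<^bsub>A\<^esub> q f)"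
proof -
  interpret presentation V "tideal V R0" A q by fact
  interpret ring A by (rule ring_A)
  define I where "I = Idl\<^bsub>A\<^esub> (q ` R)"
  let ?K = "tideal V (R0 \<union> R)"
  have qR: "q ` R \<subseteq> carrier A" using R by auto
  have I: "ideal I A" unfolding I_def by (rule genideal_ideal[OF qR])
  interpret I: ideal I A by (rule I)
  have K_free: "f \<in> free_carrier V" if "f \<in> ?K" for f
    using tideal_subset[OF that] R0 R by auto
  have 1: "q f \<in> I" if "f \<in> ?K" for f
    using that
  proof (induction rule: tideal.induct)
    case zero
    then show ?case by (simp add: q_zero)
  next
    case (step f us ws r c)
    have r: "r \<in> free_carrier V" using step R0 R by auto
    \<comment> \<open>A relation from \<open>R\<close> is a generator of \<open>I\<close>; one from
      \<open>R0\<close> is already zero in \<open>A\<close>.\<close>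
    have "q r \<in> I"
    proof (cases "r \<in> R")
      case True
      then show ?thesis unfolding I_def by (intro genideal_self[OF qR, THEN subsetD]) auto
    next
      case False
      then have "r - 0 \<in> tideal V R0" using step tideal_incl by auto
      then have "q r = \<zero>\<^bsub>A\<^esub>" using ker[of r 0] r q_zero by simp
      then show ?thesis by simp
    qed
    then have "q ((scal c * wd us) * (r * wd ws)) \<in> I"
      using step r by (simp add: q_mult I.I_l_closed I.I_r_closed)
    then show ?case using step K_free r by (simp add: q_add mult.assoc)
  qed
  \<comment> \<open>Gives the reverse inclusion: \<open>I\<close> is the least ideal containing the
    classes of \<open>R\<close>.\<close>
  have "ideal (q ` ?K) A"
  proof (rule idealI[OF ring_A])
    show "subgroup (q ` ?K) (add_monoid A)"
    proof (rule group.subgroupI)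
      show "group (add_monoid A)" by (rule a_group)
      show "q ` ?K \<subseteq> carrier (add_monoid A)" using K_free by auto
      show "q ` ?K \<noteq> {}" using tideal.zero by auto
      show "inv\<^bsub>add_monoid A\<^esub> a \<in> q ` ?K" if "a \<in> q ` ?K" for a
        using that K_free by (auto simp flip: q_uminus a_inv_def intro: tideal_uminus)
      show "a \<otimes>\<^bsub>add_monoid A\<^esub> b \<in> q ` ?K" if "a \<in> q ` ?K" "b \<in> q ` ?K" for a b
        using that K_free by (auto simp flip: q_add intro: tideal_add)
    qed
    show "x \<otimes>\<^bsub>A\<^esub> a \<in> q ` ?K" "a \<otimes>\<^bsub>A\<^esub> x \<in> q ` ?K"
      if "a \<in> q ` ?K" "x \<in> carrier A" for a x
    proof -
      obtain f where "f \<in> free_carrier V" "x = q f" using \<open>x \<in> carrier A\<close> by (rule carrierE)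
      moreover obtain g where "g \<in> ?K" "a = q g" using \<open>a \<in> q ` ?K\<close> by auto
      ultimately show "x \<otimes>\<^bsub>A\<^esub> a \<in> q ` ?K" "a \<otimes>\<^bsub>A\<^esub> x \<in> q ` ?K"
        using K_free tideal_left[of f V g] tideal_right[of f V g] by (auto simp flip: q_mult)
    qed
  qed
  then have "I \<subseteq> q ` ?K"
    unfolding I_def by (intro genideal_minimal) (auto intro!: imageI tideal_incl)
  have 2: "f \<in> ?K" if "q f \<in> I" and f: "f \<in> free_carrier V" for f
  proof -
    have "q f \<in> q ` ?K" using that(1) \<open>I \<subseteq> q ` ?K\<close> by (rule rev_subsetD)
    then obtain g where g: "q f = q g" "g \<in> ?K" by (rule imageE)
    \<comment> \<open>Equal classes in \<open>A\<close> agree only modulo \<open>R0\<close>, but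
      those relations are among the ones generating \<open>?K\<close>.\<close>
    then have "f - g \<in> tideal V R0" using ker f K_free by simp
    then have "f - g \<in> ?K" by (rule tideal_mono) (auto intro: tideal_incl)
    then show ?thesis using tideal_add[of "f - g", OF _ g(2)] by simp
  qed
  have eq: "(I +>\<^bsub>A\<^esub> q f = I +>\<^bsub>A\<^esub> q g) = (f - g \<in> ?K)"
    if "f \<in> free_carrier V" "g \<in> free_carrier V" for f g
    using quotient_eq_iff_same_a_r_cos[OF I, of "q f" "q g"] that 1 2 by (auto simp flip: q_diff)
  \<comment> \<open>Scalar multiplication in \<open>alg_quot\<close> is a union over all members of
    a coset. Each member contributes the same coset and there is at least one member, so the union
    is that coset.\<close>
  have smult: "(\<Union>x\<in>I +>\<^bsub>A\<^esub> q f. I +>\<^bsub>A\<^esub> (c \<odot>\<^bsub>A\<^esub> x)) = I +>\<^bsub>A\<^esub> q (scal c * f)"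
    if f: "f \<in> free_carrier V" for c f
  proof -
    have "I +>\<^bsub>A\<^esub> (c \<odot>\<^bsub>A\<^esub> x) = I +>\<^bsub>A\<^esub> q (scal c * f)" if x: "x \<in> I +>\<^bsub>A\<^esub> q f" for x
    proof -
      obtain i where i: "i \<in> I" "x = i \<oplus>\<^bsub>A\<^esub> q f" using x unfolding a_r_coset_def' by auto
      have "i \<in> q ` ?K" using i(1) \<open>I \<subseteq> q ` ?K\<close> by (rule rev_subsetD)
      then obtain g where g: "g \<in> ?K" "x = q g \<oplus>\<^bsub>A\<^esub> q f" using i(2) by auto
      then have "c \<odot>\<^bsub>A\<^esub> x = q (scal c * (g + f))"
        using f K_free by (simp add: q_smult q_add)
      moreover have "scal c * (g + f) - scal c * f \<in> ?K"
        using tideal_scal[OF g(1)] by (simp add: algebra_simps)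
      ultimately show ?thesis
        using f K_free g by (subst \<open>c \<odot>\<^bsub>A\<^esub> x = _\<close>, subst eq) auto
    qed
    moreover have "q f \<in> I +>\<^bsub>A\<^esub> q f" using f by (simp add: I.a_rcos_self)
    ultimately show ?thesis by blast
  qed
  show ?thesis unfolding I_def[symmetric]
  proof
    show "(\<lambda>f. I +>\<^bsub>A\<^esub> q f) ` free_carrier V = carrier (alg_quot A I)"
      by (auto simp: alg_quot_def FactRing_def A_RCOSETS_def' simp flip: onto)
  next
    fix f g :: "'a word \<Rightarrow>\<^sub>0 'b" and c
    assume f: "f \<in> free_carrier V"
    show "I +>\<^bsub>A\<^esub> q (scal c * f) = c \<odot>\<^bsub>alg_quot A I\<^esub> (I +>\<^bsub>A\<^esub> q f)"
      using smult[OF f] by (simp add: alg_quot_def)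
    assume g: "g \<in> free_carrier V"
    show "(I +>\<^bsub>A\<^esub> q f = I +>\<^bsub>A\<^esub> q g) = (f - g \<in> ?K)" using f g by (rule eq)
    show "I +>\<^bsub>A\<^esub> q (f + g) = (I +>\<^bsub>A\<^esub> q f) \<oplus>\<^bsub>alg_quot A I\<^esub> (I +>\<^bsub>A\<^esub> q g)"
      using f g by (simp add: alg_quot_def FactRing_def I.a_rcos_sum q_add)
    show "I +>\<^bsub>A\<^esub> q (f * g) = (I +>\<^bsub>A\<^esub> q f) \<otimes>\<^bsub>alg_quot A I\<^esub> (I +>\<^bsub>A\<^esub> q g)"
      using f g by (simp add: alg_quot_def FactRing_def I.rcoset_mult_add q_mult)
  next
    show "I +>\<^bsub>A\<^esub> q 1 = \<one>\<^bsub>alg_quot A I\<^esub>" by (simp add: alg_quot_def FactRing_def q_one)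
    show "I +>\<^bsub>A\<^esub> q 0 = \<zero>\<^bsub>alg_quot A I\<^esub>"
      by (simp add: alg_quot_def FactRing_def q_zero I.a_rcos_const)
  qed
qed


section \<open>The Wick functional\<close>

text \<open>\<open>wick \<omega> \<xi> d\<close> is the value at \<open>\<xi>\<close> of the degree \<open>d\<close> part of the Weyl symbol of a word:
  the sum over all ways of pairing off letters, a pair contributing \<open>\<omega> / 2\<close>, such that
  \<open>d\<close> unpaired letters remain.\<close>

function wick :: "('v \<Rightarrow> 'v \<Rightarrow> 'k::field) \<Rightarrow> ('v \<Rightarrow> 'k) \<Rightarrow> nat \<Rightarrow> 'v list \<Rightarrow> 'k" where
  "wick \<omega> \<xi> d [] = (if d = 0 then 1 else 0)"
| "wick \<omega> \<xi> d (x # w) = (if d = 0 then 0 else \<xi> x * wick \<omega> \<xi> (d - 1) w) +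
     (\<Sum>j<length w. \<omega> x (w ! j) * wick \<omega> \<xi> d (take j w @ drop (Suc j) w)) / 2"
  by pat_completeness auto
termination by (relation "measure (\<lambda>(\<omega>, \<xi>, d, w). length w)") auto

text \<open>The pairing sum of \<open>wick\<close> without its factor 1/2, with the function of the
  remaining word left free so that contractions can be nested and commuted.\<close>

definition contract :: "('v \<Rightarrow> 'v \<Rightarrow> 'k::field) \<Rightarrow> 'v \<Rightarrow> ('v list \<Rightarrow> 'k) \<Rightarrow> 'v list \<Rightarrow> 'k" where
  "contract \<omega> x f w = (\<Sum>j<length w. \<omega> x (w ! j) * f (take j w @ drop (Suc j) w))"

lemma wick_Cons:
  "wick \<omega> \<xi> d (x # w) = (if d = 0 then 0 else \<xi> x * wick \<omega> \<xi> (d - 1) w) + contract \<omega> x (wick \<omega> \<xi> d) w / 2"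
  by (simp add: contract_def)

declare wick.simps(2) [simp del]

lemma contract_Nil [simp]: "contract \<omega> x f [] = 0"
  by (simp add: contract_def)

lemma contract_Cons: "contract \<omega> x f (a # w) = \<omega> x a * f w + contract \<omega> x (\<lambda>t. f (a # t)) w"
  by (simp add: contract_def sum.lessThan_Suc_shift del: sum.lessThan_Suc)

lemma contract_append:
  "contract \<omega> x f (u @ v) = contract \<omega> x (\<lambda>t. f (t @ v)) u + contract \<omega> x (\<lambda>t. f (u @ t)) v"
  by (induction u arbitrary: f) (simp_all add: contract_Cons)

lemma contract_add: "contract \<omega> x (\<lambda>t. f t + g t) w = contract \<omega> x f w + contract \<omega> x g w"
  by (simp add: contract_def distrib_left sum.distrib)

lemma contract_cmult: "contract \<omega> x (\<lambda>t. c * f t) w = c * contract \<omega> x f w"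
  by (simp add: contract_def sum_distrib_left mult_ac)

lemma contract_zero [simp]: "contract \<omega> x (\<lambda>t. 0) w = 0"
  by (simp add: contract_def)

lemma contract_divide: "contract \<omega> x (\<lambda>t. f t / c) w = contract \<omega> x f w / c"
  using contract_cmult[of \<omega> x "inverse c" f w] by (simp add: field_simps)

text \<open>Only words one letter shorter, with letters from \<open>w\<close>, are ever evaluated.
  This is the form in which induction hypotheses on length enter a contraction.\<close>

lemma contract_cong:
  assumes "\<And>t. Suc (length t) = length w \<Longrightarrow> set t \<subseteq> set w \<Longrightarrow> f t = g t"
  shows "contract \<omega> x f w = contract \<omega> x g w"
  unfolding contract_def
proof (rule sum.cong[OF refl])
  fix j assume "j \<in> {..<length w}"
  moreover have "set (take j w @ drop (Suc j) w) \<subseteq> set w"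
    using set_take_subset[of j w] set_drop_subset[of "Suc j" w] by auto
  ultimately show "\<omega> x (w ! j) * f (take j w @ drop (Suc j) w) = \<omega> x (w ! j) * g (take j w @ drop (Suc j) w)"
    using assms[of "take j w @ drop (Suc j) w"] by simp
qed

text \<open>Both sides sum over ordered pairs of distinct positions, one paired with
  \<open>x\<close> and the other with \<open>y\<close>.\<close>

lemma contract_commute:
  "contract \<omega> x (contract \<omega> y f) w = contract \<omega> y (contract \<omega> x f) w"
  by (induction w arbitrary: f) (simp_all add: contract_Cons contract_add contract_cmult)

text \<open>Exchanging two neighbours affects only the pairings that join them to each other: their
  weight changes from \<omega> x y / 2 to \<omega> y x / 2, and by antisymmetry the difference is
  \<omega> x y. The commutation relation of the Weyl algebra is thus respected precisely because of
  the factor 1/2.\<close>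

lemma wick_swap:
  fixes \<omega> :: "'v \<Rightarrow> 'v \<Rightarrow> 'k::field_char_0"
  assumes anti: "\<And>x y. \<omega> y x = - \<omega> x y"
  shows "wick \<omega> \<xi> d (u @ x # y # w) = wick \<omega> \<xi> d (u @ y # x # w) + \<omega> x y * wick \<omega> \<xi> d (u @ w)"
proof (induction "length u + length w" arbitrary: u w d rule: less_induct)
  case less
  show ?case
  proof (cases u)
    case Nil
    \<comment> \<open>Expanding both leading letters isolates the pairing of a with b; the doubly
      contracted term is symmetric in a and b by \<open>contract_commute\<close>.\<close>
    have "contract \<omega> a (wick \<omega> \<xi> d) (b # w) = \<omega> a b * wick \<omega> \<xi> d w +
        (if d = 0 then 0 else \<xi> b * contract \<omega> a (wick \<omega> \<xi> (d - 1)) w)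
        + contract \<omega> a (contract \<omega> b (wick \<omega> \<xi> d)) w / 2" for a b
      by (simp add: contract_Cons wick_Cons contract_add contract_cmult contract_divide)
    then show ?thesis
      using anti[of x y] contract_commute[of \<omega> x y]
      by (simp add: Nil wick_Cons field_simps)
  next
    case (Cons a u')
    have 1: "contract \<omega> a (\<lambda>t. wick \<omega> \<xi> d (t @ x # y # w)) u' =
        contract \<omega> a (\<lambda>t. wick \<omega> \<xi> d (t @ y # x # w) + \<omega> x y * wick \<omega> \<xi> d (t @ w)) u'"
      by (rule contract_cong, rule less) (simp add: Cons)
    have 2: "contract \<omega> a (\<lambda>t. wick \<omega> \<xi> d (u' @ x # y # t)) w =
        contract \<omega> a (\<lambda>t. wick \<omega> \<xi> d (u' @ y # x # t) + \<omega> x y * wick \<omega> \<xi> d (u' @ t)) w"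
      by (rule contract_cong, rule less) (simp add: Cons)
    have 3: "wick \<omega> \<xi> e (u' @ x # y # w) =
        wick \<omega> \<xi> e (u' @ y # x # w) + \<omega> x y * wick \<omega> \<xi> e (u' @ w)" for e
      by (rule less) (simp add: Cons)
    show ?thesis
      by (simp add: Cons wick_Cons contract_append contract_Cons 1 2 3 contract_add contract_cmult)
         (simp add: algebra_simps add_divide_distrib)
  qed
qed

text \<open>A letter enters only through its value under \<xi> and its pairings with the other
  letters. The two coefficients cover additivity (1, 1) and scaling (c, 0) in one induction.\<close>

lemma wick_linear:
  fixes \<omega> :: "'v \<Rightarrow> 'v \<Rightarrow> 'k::field"
  assumes "\<xi> p = \<alpha> * \<xi> q + \<beta> * \<xi> r"
    and L: "\<And>a. a \<in> V \<Longrightarrow> \<omega> p a = \<alpha> * \<omega> q a + \<beta> * \<omega> r a"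
    and R: "\<And>a. a \<in> V \<Longrightarrow> \<omega> a p = \<alpha> * \<omega> a q + \<beta> * \<omega> a r"
    and "set u \<subseteq> V" "set w \<subseteq> V"
  shows "wick \<omega> \<xi> d (u @ p # w) = \<alpha> * wick \<omega> \<xi> d (u @ q # w) + \<beta> * wick \<omega> \<xi> d (u @ r # w)"
  using assms(4,5)
proof (induction "length u + length w" arbitrary: u w d rule: less_induct)
  case less
  show ?case
  proof (cases u)
    case Nil
    have "contract \<omega> p f w = \<alpha> * contract \<omega> q f w + \<beta> * contract \<omega> r f w" for f
    proof -
      have "contract \<omega> p f w = (\<Sum>j<length w. \<alpha> * (\<omega> q (w ! j) * f (take j w @ drop (Suc j) w))
          + \<beta> * (\<omega> r (w ! j) * f (take j w @ drop (Suc j) w)))"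
        unfolding contract_def using less.prems
        by (intro sum.cong refl) (subst L, auto simp: algebra_simps)
      then show ?thesis by (simp add: contract_def sum.distrib sum_distrib_left)
    qed
    then show ?thesis
      using assms(1) by (simp add: Nil wick_Cons algebra_simps add_divide_distrib)
  next
    case (Cons a u')
    then have a: "a \<in> V" "set u' \<subseteq> V" using less.prems by auto
    have 1: "contract \<omega> a (\<lambda>t. wick \<omega> \<xi> d (t @ p # w)) u' =
        contract \<omega> a (\<lambda>t. \<alpha> * wick \<omega> \<xi> d (t @ q # w) + \<beta> * wick \<omega> \<xi> d (t @ r # w)) u'"
      by (rule contract_cong, rule less) (use Cons a less.prems in auto)
    have 2: "contract \<omega> a (\<lambda>t. wick \<omega> \<xi> d (u' @ p # t)) w =
        contract \<omega> a (\<lambda>t. \<alpha> * wick \<omega> \<xi> d (u' @ q # t) + \<beta> * wick \<omega> \<xi> d (u' @ r # t)) w"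
      by (rule contract_cong, rule less) (use Cons a less.prems in auto)
    have 3: "wick \<omega> \<xi> e (u' @ p # w) =
        \<alpha> * wick \<omega> \<xi> e (u' @ q # w) + \<beta> * wick \<omega> \<xi> e (u' @ r # w)" for e
      by (rule less) (use Cons a less.prems in auto)
    show ?thesis
      by (simp add: Cons wick_Cons contract_append contract_Cons 1 2 3 contract_add contract_cmult R[OF a(1)])
         (simp add: algebra_simps add_divide_distrib)
  qed
qed

lemma wick_eq_0: "length w < d \<Longrightarrow> wick \<omega> \<xi> d w = 0"
proof (induction "length w" arbitrary: w d rule: less_induct)
  case less
  show ?case
  proof (cases w)
    case (Cons x w')
    have "contract \<omega> x (wick \<omega> \<xi> d) w' = contract \<omega> x (\<lambda>t. 0) w'"
      by (rule contract_cong, rule less) (use less.prems Cons in auto)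
    moreover have "wick \<omega> \<xi> (d - 1) w' = 0"
      by (rule less) (use less.prems Cons in auto)
    ultimately show ?thesis by (simp add: Cons wick_Cons contract_def)
  qed (use less in simp)
qed

text \<open>When every letter must stay unpaired, each contraction has too few letters left and
  vanishes.\<close>

lemma wick_length: "wick \<omega> \<xi> (length w) w = prod_list (map \<xi> w)"
proof (induction w)
  case (Cons x w)
  have "contract \<omega> x (wick \<omega> \<xi> (Suc (length w))) w = contract \<omega> x (\<lambda>t. 0) w"
    by (rule contract_cong, rule wick_eq_0) auto
  with Cons show ?case by (simp add: wick_Cons contract_def)
qed simp

section \<open>Cancellation of contractions in a sum over all permutations\<close>

lemma sum_permutations_antisym:
  fixes T :: "(nat \<Rightarrow> nat) \<Rightarrow> 'k::field_char_0"
  assumes "a \<in> S" "b \<in> S"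
    and "\<And>\<sigma>. \<sigma> permutes S \<Longrightarrow> T (\<sigma> \<circ> Transposition.transpose a b) = - T \<sigma>"
  shows "(\<Sum>\<sigma>\<in>{\<sigma>. \<sigma> permutes S}. T \<sigma>) = 0"
proof -
  have "(\<Sum>\<sigma>\<in>{\<sigma>. \<sigma> permutes S}. T \<sigma>) =
      (\<Sum>\<sigma>\<in>{\<sigma>. \<sigma> permutes S}. T (\<sigma> \<circ> Transposition.transpose a b))"
    by (rule sum_permutations_compose_right) (rule permutes_swap_id[OF assms(1,2)])
  also have "\<dots> = (\<Sum>\<sigma>\<in>{\<sigma>. \<sigma> permutes S}. - T \<sigma>)"
    using assms(3) by (intro sum.cong) auto
  finally show ?thesis by (simp add: sum_negf)
qed

text \<open>In the sum over all orders, the terms pairing the current first letter cancel, because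
  transposing the two partners reverses the sign of \<omega>. Hence letters can be peeled off one
  after another as factors \<xi>, each lowering the degree by one; the guard
  \<open>m \<le> d\<close> replaces the truncated difference once the degree is used up.\<close>

lemma sum_permutations_wick_step:
  fixes \<omega> :: "'v \<Rightarrow> 'v \<Rightarrow> 'k::field_char_0"
  assumes anti: "\<And>x y. \<omega> y x = - \<omega> x y" and "m \<le> length vs"
  shows "(\<Sum>\<sigma>\<in>{\<sigma>. \<sigma> permutes {..<length vs}}. wick \<omega> \<xi> d (map (\<lambda>i. vs ! \<sigma> i) [0..<length vs])) =
    (\<Sum>\<sigma>\<in>{\<sigma>. \<sigma> permutes {..<length vs}}. (\<Prod>i<m. \<xi> (vs ! \<sigma> i)) *
        (if m \<le> d then wick \<omega> \<xi> (d - m) (map (\<lambda>i. vs ! \<sigma> i) [m..<length vs]) else 0))"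
  using assms(2)
proof (induction m)
  case 0
  then show ?case by simp
next
  case (Suc m)
  let ?n = "length vs" and ?L = "\<lambda>j. take j [Suc m..<length vs] @ drop (Suc j) [Suc m..<length vs]"
  define P where "P \<sigma> = (\<Prod>i<m. \<xi> (vs ! \<sigma> i))" for \<sigma> :: "nat \<Rightarrow> nat"
  define C where "C \<sigma> = contract \<omega> (vs ! \<sigma> m) (wick \<omega> \<xi> (d - m)) (map (\<lambda>i. vs ! \<sigma> i) [Suc m..<?n])"
    for \<sigma> :: "nat \<Rightarrow> nat"
  have "(\<Sum>\<sigma>\<in>{\<sigma>. \<sigma> permutes {..<?n}}. P \<sigma> * C \<sigma>) =
     (\<Sum>\<sigma>\<in>{\<sigma>. \<sigma> permutes {..<?n}}. \<Sum>j<?n - Suc m.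
        P \<sigma> * \<omega> (vs ! \<sigma> m) (vs ! \<sigma> (Suc m + j)) * wick \<omega> \<xi> (d - m) (map (\<lambda>i. vs ! \<sigma> i) (?L j)))"
    unfolding C_def contract_def sum_distrib_left
    by (auto intro!: sum.cong simp: mult.assoc take_map drop_map)
  also have "\<dots> = (\<Sum>j<?n - Suc m. \<Sum>\<sigma>\<in>{\<sigma>. \<sigma> permutes {..<?n}}.
        P \<sigma> * \<omega> (vs ! \<sigma> m) (vs ! \<sigma> (Suc m + j)) * wick \<omega> \<xi> (d - m) (map (\<lambda>i. vs ! \<sigma> i) (?L j)))"
    by (rule sum.swap)
  \<comment> \<open>For fixed j the transposed positions are m and m + 1 + j. The prefix product and
    the remaining positions \<open>?L j\<close> avoid both, so only the paired value changes, and it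
    changes sign.\<close>
  also have "\<dots> = (\<Sum>j<?n - Suc m. 0)"
  proof (intro sum.cong refl sum_permutations_antisym)
    fix j and \<sigma> :: "nat \<Rightarrow> nat"
    assume j: "j \<in> {..<?n - Suc m}"
    then show "m \<in> {..<?n}" "Suc m + j \<in> {..<?n}" by auto
    let ?s = "\<sigma> \<circ> Transposition.transpose m (Suc m + j)"
    have P: "P ?s = P \<sigma>"
      unfolding P_def by (intro prod.cong) (auto simp: transpose_def)
    have "i \<noteq> m \<and> i \<noteq> Suc m + j" if "i \<in> set (?L j)" for i
      using that j by (auto simp: take_upt simp del: upt_Suc)
    then have M: "map (\<lambda>i. vs ! ?s i) (?L j) = map (\<lambda>i. vs ! \<sigma> i) (?L j)"
      by (intro map_cong refl) (auto simp: transpose_def)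
    show "P ?s * \<omega> (vs ! ?s m) (vs ! ?s (Suc m + j)) * wick \<omega> \<xi> (d - m) (map (\<lambda>i. vs ! ?s i) (?L j)) =
      - (P \<sigma> * \<omega> (vs ! \<sigma> m) (vs ! \<sigma> (Suc m + j)) * wick \<omega> \<xi> (d - m) (map (\<lambda>i. vs ! \<sigma> i) (?L j)))"
      unfolding P M using anti[of "vs ! \<sigma> m" "vs ! \<sigma> (Suc m + j)"] by simp
  qed
  finally have 0: "(\<Sum>\<sigma>\<in>{\<sigma>. \<sigma> permutes {..<?n}}. P \<sigma> * (C \<sigma> / 2)) = 0"
    by (simp flip: sum_divide_distrib)
  have "[m..<?n] = m # [Suc m..<?n]" using Suc.prems by (simp add: upt_conv_Cons)
  then have W: "wick \<omega> \<xi> (d - m) (map (\<lambda>i. vs ! \<sigma> i) [m..<?n]) =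
      (if d - m = 0 then 0 else \<xi> (vs ! \<sigma> m) * wick \<omega> \<xi> (d - m - 1) (map (\<lambda>i. vs ! \<sigma> i) [Suc m..<?n])) + C \<sigma> / 2" for \<sigma>
    by (simp add: wick_Cons C_def)
  show ?case
  proof (cases "m \<le> d")
    case True
    have "(\<Sum>\<sigma>\<in>{\<sigma>. \<sigma> permutes {..<?n}}. P \<sigma> * wick \<omega> \<xi> (d - m) (map (\<lambda>i. vs ! \<sigma> i) [m..<?n])) =
      (\<Sum>\<sigma>\<in>{\<sigma>. \<sigma> permutes {..<?n}}. P \<sigma> *
        (if d - m = 0 then 0 else \<xi> (vs ! \<sigma> m) * wick \<omega> \<xi> (d - m - 1) (map (\<lambda>i. vs ! \<sigma> i) [Suc m..<?n])))"
      unfolding W distrib_left sum.distrib 0 by simp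
    with Suc True show ?thesis
      by (auto simp: P_def mult.assoc intro!: sum.cong)
  qed (use Suc in simp)
qed

text \<open>After all letters are peeled off only the empty word remains, and it has value 0 in
  every positive degree; if there are more letters than \<open>d\<close>, the guard makes the terms
  vanish.\<close>

lemma sum_permutations_wick:
  fixes \<omega> :: "'v \<Rightarrow> 'v \<Rightarrow> 'k::field_char_0"
  assumes "\<And>x y. \<omega> y x = - \<omega> x y" and "length vs \<noteq> d"
  shows "(\<Sum>\<sigma>\<in>{\<sigma>. \<sigma> permutes {..<length vs}}. wick \<omega> \<xi> d (map (\<lambda>i. vs ! \<sigma> i) [0..<length vs])) = 0"
  using sum_permutations_wick_step[OF assms(1) order_refl, where vs = vs and d = d and \<xi> = \<xi>] assms(2)
  by (auto intro!: sum.neutral)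


section \<open>Presentations of the symmetric, Weyl and enveloping algebras\<close>

definition lin_rel :: "('k::field \<Rightarrow> 'v::ab_group_add \<Rightarrow> 'v) \<Rightarrow> 'v set \<Rightarrow> ('v word \<Rightarrow>\<^sub>0 'k) set" where
  "lin_rel s V = {wd [v + w] - (wd [v] + wd [w]) | v w. v \<in> V \<and> w \<in> V} \<union>
     {wd [s c v] - scal c * wd [v] | c v. v \<in> V}"

text \<open>For \<omega> = 0 these are the relations of the symmetric algebra, so both quotients are
  treated alike.\<close>

definition com_rel :: "'v set \<Rightarrow> ('v \<Rightarrow> 'v \<Rightarrow> 'k::field) \<Rightarrow> ('v word \<Rightarrow>\<^sub>0 'k) set" where
  "com_rel V \<omega> = {wd [v, w] - wd [w, v] - scal (\<omega> v w) | v w. v \<in> V \<and> w \<in> V}"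

definition lie_rel :: "'v set \<Rightarrow> ('v \<Rightarrow> 'v \<Rightarrow> 'v) \<Rightarrow> ('v word \<Rightarrow>\<^sub>0 'k::field) set" where
  "lie_rel V br = {wd [v, w] - wd [w, v] - wd [br v w] | v w. v \<in> V \<and> w \<in> V}"

definition tensor_cls ::
  "('k::field \<Rightarrow> 'v::ab_group_add \<Rightarrow> 'v) \<Rightarrow> 'v set \<Rightarrow> ('v word \<Rightarrow>\<^sub>0 'k) \<Rightarrow> ('v word \<Rightarrow>\<^sub>0 'k) set" where
  "tensor_cls s V f = linearity_ideal s V +>\<^bsub>free_alg V\<^esub> f"

definition quot_cls ::
  "('k::field \<Rightarrow> 'v::ab_group_add \<Rightarrow> 'v) \<Rightarrow> 'v set \<Rightarrow> ('v word \<Rightarrow>\<^sub>0 'k) set set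
     \<Rightarrow> ('v word \<Rightarrow>\<^sub>0 'k) \<Rightarrow> ('v word \<Rightarrow>\<^sub>0 'k) set set" where
  "quot_cls s V I f = I +>\<^bsub>tensor_alg s V\<^esub> tensor_cls s V f"

text \<open>Brings the generators of \<open>sym_ideal\<close>, \<open>weyl_ideal\<close> and
  \<open>env_ideal\<close> into the form of an image under \<open>tensor_cls\<close>, as
  \<open>presentation_quot\<close> expects.\<close>

lemma Collect2_eq_image:
  assumes "\<And>v w. v \<in> V \<Longrightarrow> w \<in> V \<Longrightarrow> F v w = G (H v w)"
  shows "{F v w | v w. v \<in> V \<and> w \<in> V} = G ` {H v w | v w. v \<in> V \<and> w \<in> V}"
  using assms by force

text \<open>What keeps the letters \<open>v + w\<close> and \<open>s c v\<close> of the linearity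
  relations inside the alphabet.\<close>

locale linear_closed =
  fixes s :: "'k::field \<Rightarrow> 'v::ab_group_add \<Rightarrow> 'v" and V :: "'v set"
  assumes add_closed: "v \<in> V \<Longrightarrow> w \<in> V \<Longrightarrow> v + w \<in> V"
    and scale_closed: "v \<in> V \<Longrightarrow> s c v \<in> V"
begin

lemma lin_rel_free: "lin_rel s V \<subseteq> free_carrier V"
  by (auto simp: lin_rel_def add_closed scale_closed)

lemma com_rel_free: "com_rel V \<omega> \<subseteq> (free_carrier V :: ('v word \<Rightarrow>\<^sub>0 'k) set)"
  by (auto simp: com_rel_def)

lemma presentation_tensor:
  "presentation V (tideal V (lin_rel s V)) (tensor_alg s V) (tensor_cls s V)"
proof -
  have "linearity_ideal s V = Idl\<^bsub>free_alg V\<^esub> ((\<lambda>f. f) ` lin_rel s V)"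
    by (simp add: linearity_ideal_def lin_rel_def free_gen_eq_wd)
  then show ?thesis
    using presentation_quot[OF presentation_free empty_subsetI lin_rel_free]
    by (simp add: tensor_alg_def tensor_cls_def[abs_def])
qed

sublocale T: presentation V "tideal V (lin_rel s V)" "tensor_alg s V" "tensor_cls s V"
  by (rule presentation_tensor)

lemma tensor_gen_eq: "tensor_gen s V v = tensor_cls s V (wd [v])"
  by (simp add: tensor_gen_def tensor_cls_def free_gen_eq_wd)

lemma presentation_tensor_quot:
  assumes "R \<subseteq> free_carrier V" "I = Idl\<^bsub>tensor_alg s V\<^esub> (tensor_cls s V ` R)"
  shows "presentation V (tideal V (lin_rel s V \<union> R)) (alg_quot (tensor_alg s V) I) (quot_cls s V I)"
  using presentation_quot[OF presentation_tensor lin_rel_free assms(1)] assms(2)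
  by (simp add: quot_cls_def[abs_def])

lemma presentation_sym:
  "presentation V (tideal V (lin_rel s V \<union> com_rel V (\<lambda>_ _. 0))) (sym_alg s V) (quot_cls s V (sym_ideal s V))"
proof -
  have "sym_ideal s V = Idl\<^bsub>tensor_alg s V\<^esub> (tensor_cls s V ` com_rel V (\<lambda>_ _. 0))"
    unfolding sym_ideal_def Let_def com_rel_def
    by (subst Collect2_eq_image[where G = "tensor_cls s V"])
       (auto simp: tensor_gen_eq wd_Cons[of _ "[_]"] simp flip: T.q_mult T.q_diff)
  with com_rel_free show ?thesis
    unfolding sym_alg_def by (intro presentation_tensor_quot)
qed

lemma presentation_weyl:
  "presentation V (tideal V (lin_rel s V \<union> com_rel V \<omega>)) (weyl_alg s V \<omega>) (quot_cls s V (weyl_ideal s V \<omega>))"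
proof -
  have "weyl_ideal s V \<omega> = Idl\<^bsub>tensor_alg s V\<^esub> (tensor_cls s V ` com_rel V \<omega>)"
    unfolding weyl_ideal_def Let_def com_rel_def
    by (subst Collect2_eq_image[where G = "tensor_cls s V"])
       (auto simp: tensor_gen_eq wd_Cons[of _ "[_]"] simp flip: T.q_mult T.q_diff T.q_one T.q_smult)
  with com_rel_free show ?thesis
    unfolding weyl_alg_def by (intro presentation_tensor_quot)
qed

lemma presentation_env:
  assumes "\<And>v w. v \<in> V \<Longrightarrow> w \<in> V \<Longrightarrow> br v w \<in> V"
  shows "presentation V (tideal V (lin_rel s V \<union> lie_rel V br)) (env_alg s br V)
    (quot_cls s V (env_ideal s br V))"
proof -
  have "env_ideal s br V = Idl\<^bsub>tensor_alg s V\<^esub> (tensor_cls s V ` lie_rel V br)"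
    unfolding env_ideal_def Let_def lie_rel_def using assms
    by (subst Collect2_eq_image[where G = "tensor_cls s V"])
       (auto simp: tensor_gen_eq wd_Cons[of _ "[_]"] simp flip: T.q_mult T.q_diff)
  moreover have "lie_rel V br \<subseteq> (free_carrier V :: ('v word \<Rightarrow>\<^sub>0 'k) set)"
    using assms by (auto simp: lie_rel_def)
  ultimately show ?thesis
    unfolding env_alg_def by (intro presentation_tensor_quot)
qed

lemma sym_gen_eq: "sym_gen s V v = quot_cls s V (sym_ideal s V) (wd [v])"
  by (simp add: sym_gen_def quot_cls_def tensor_gen_eq)

lemma weyl_gen_eq: "weyl_gen s V \<omega> v = quot_cls s V (weyl_ideal s V \<omega>) (wd [v])"
  by (simp add: weyl_gen_def quot_cls_def tensor_gen_eq)

lemma env_gen_eq: "env_gen s br V v = quot_cls s V (env_ideal s br V) (wd [v])"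
  by (simp add: env_gen_def quot_cls_def tensor_gen_eq)

lemma sym_power_eq:
  "sym_power s V d = quot_cls s V (sym_ideal s V) `
     {f \<in> free_carrier V. \<forall>u\<in>Poly_Mapping.keys f. length (letters u) = d}"
  by (simp add: sym_power_def tensor_power_def quot_cls_def[abs_def] image_image
      flip: tensor_cls_def)

end

section \<open>Maps induced on quotients\<close>

lemma presentation_induced:
  assumes "presentation V J A q" "presentation V' J' A' q'"
    and T: "\<And>f. f \<in> free_carrier V \<Longrightarrow> T f \<in> free_carrier V'"
    and add: "\<And>f g. T (f + g) = T f + T g"
    and scal: "\<And>c f. T (scal c * f) = scal c * T f"
    and J: "\<And>f. f \<in> J \<Longrightarrow> T f \<in> J'"
  obtains Q where "Q \<in> linear_maps A A'" "\<And>f. f \<in> free_carrier V \<Longrightarrow> Q (q f) = q' (T f)"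
proof -
  interpret A: presentation V J A q by fact
  interpret A': presentation V' J' A' q' by fact
  have diff: "T (f - g) = T f - T g" for f g
    using add[of "f - g" g] by simp
  \<comment> \<open>The representative chosen by \<open>inv_into\<close> is immaterial: two of them
    differ by an element of \<open>J\<close>, which \<open>T\<close> sends into
    \<open>J'\<close>.\<close>
  define Q where "Q X = q' (T (inv_into (free_carrier V) q X))" for X
  have Q: "Q (q f) = q' (T f)" if f: "f \<in> free_carrier V" for f
  proof -
    let ?g = "inv_into (free_carrier V) q (q f)"
    have g: "?g \<in> free_carrier V" "q ?g = q f"
      using f by (auto intro: inv_into_into f_inv_into_f)
    then have "T (?g - f) \<in> J'" using A.ker f J by blast
    then show ?thesis using A'.ker T f g(1) by (simp add: Q_def diff)
  qed
  have "Q \<in> linear_maps A A'"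
    by (auto simp: linear_maps_def Q T add scal A'.q_add A'.q_smult elim!: A.carrierE
        simp flip: A.q_add A.q_smult)
  then show ?thesis using Q by (rule that)
qed

lemma presentation_induced_alg_hom:
  assumes "presentation V J A q" "presentation V' J' A' q'"
    and T: "\<And>f. f \<in> free_carrier V \<Longrightarrow> T f \<in> free_carrier V'"
    and mult: "\<And>f g. T (f * g) = T f * T g" "T 1 = 1"
    and Q: "Q \<in> linear_maps A A'" "\<And>f. f \<in> free_carrier V \<Longrightarrow> Q (q f) = q' (T f)"
  shows "Q \<in> alg_hom A A'"
proof -
  interpret A: presentation V J A q by fact
  interpret A': presentation V' J' A' q' by fact
  have "Q \<in> ring_hom A A'"
  proof (rule ring_hom_memI)
    show "Q x \<in> carrier A'" if "x \<in> carrier A" for x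
      using that Q(1) by (auto simp: linear_maps_def)
    show "Q (x \<oplus>\<^bsub>A\<^esub> y) = Q x \<oplus>\<^bsub>A'\<^esub> Q y" if "x \<in> carrier A" "y \<in> carrier A" for x y
      using that Q(1) by (auto simp: linear_maps_def)
    show "Q (x \<otimes>\<^bsub>A\<^esub> y) = Q x \<otimes>\<^bsub>A'\<^esub> Q y" if "x \<in> carrier A" "y \<in> carrier A" for x y
      using that by (auto simp: Q mult T A'.q_mult elim!: A.carrierE simp flip: A.q_mult)
    show "Q \<one>\<^bsub>A\<^esub> = \<one>\<^bsub>A'\<^esub>"
      using Q(2)[of 1] by (simp add: mult A.q_one A'.q_one)
  qed
  then show ?thesis using Q(1) by (simp add: alg_hom_def)
qed

section \<open>Symmetrization\<close>

definition perm_sum :: "'v list \<Rightarrow> ('v word \<Rightarrow>\<^sub>0 'k::field)" where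
  "perm_sum vs = (\<Sum>\<sigma>\<in>{\<sigma>. \<sigma> permutes {..<length vs}}. wd (map (\<lambda>i. vs ! \<sigma> i) [0..<length vs]))"

text \<open>The symmetrization map lifted to representatives, before any relation of the target is
  imposed; the same lift serves every \<omega>.\<close>

definition symz :: "('v word \<Rightarrow>\<^sub>0 'k::field_char_0) \<Rightarrow> ('v word \<Rightarrow>\<^sub>0 'k)" where
  "symz = lext (\<lambda>vs. scal (inverse (fact (length vs))) * perm_sum vs)"

lemma mset_permuted: "\<sigma> permutes {..<length vs} \<Longrightarrow> mset (map (\<lambda>i. vs ! \<sigma> i) [0..<length vs]) = mset vs"
  using mset_permute_list[of \<sigma> vs] by (simp add: permute_list_def)

lemma permuted_letters: "\<sigma> permutes {..<length vs} \<Longrightarrow> set (map (\<lambda>i. vs ! \<sigma> i) [0..<length vs]) = set vs"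
  by (metis mset_permuted set_mset_mset)

lemma perm_sum_in_free: "set vs \<subseteq> V \<Longrightarrow> perm_sum vs \<in> free_carrier V"
  unfolding perm_sum_def by (intro sum_in_free wd_in_free) (simp add: permuted_letters del: set_map)

lemma symz_in_free: "f \<in> free_carrier V \<Longrightarrow> symz f \<in> free_carrier V"
  unfolding symz_def by (rule lext_in_free) (auto simp: perm_sum_in_free)

text \<open>Swapping two letters amounts to composing each permutation on the left with a
  transposition, which only reindexes the sum. The equality therefore holds in the free algebra
  itself.\<close>

lemma perm_sum_swap: "perm_sum (u @ x # y # w) = perm_sum (u @ y # x # w)"
proof -
  let ?n = "Suc (Suc (length u + length w))" and ?\<tau> = "Transposition.transpose (length u) (Suc (length u))"
  have \<tau>: "?\<tau> permutes {..<?n}" by (rule permutes_swap_id) auto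
  have nth: "(u @ x # y # w) ! (?\<tau> i) = (u @ y # x # w) ! i" for i
    by (auto simp: transpose_def nth_append nth_Cons split: nat.splits)
  have "perm_sum (u @ x # y # w) =
      (\<Sum>\<sigma>\<in>(\<circ>) ?\<tau> ` {\<sigma>. \<sigma> permutes {..<?n}}. wd (map (\<lambda>i. (u @ x # y # w) ! \<sigma> i) [0..<?n]))"
    using image_compose_permutations_left[OF \<tau>] by (simp add: perm_sum_def setcompr_eq_image del: upt_Suc)
  also have "\<dots> = (\<Sum>\<sigma>\<in>{\<sigma>. \<sigma> permutes {..<?n}}. wd (map (\<lambda>i. (u @ x # y # w) ! (?\<tau> \<circ> \<sigma>) i) [0..<?n]))"
    by (rule sum.reindex_cong[OF inj_on_subset[OF fun.inj_map[OF permutes_inj[OF \<tau>]]] refl refl]) simp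
  also have "\<dots> = perm_sum (u @ y # x # w)"
    by (simp add: perm_sum_def nth del: upt_Suc)
  finally show ?thesis .
qed

text \<open>The place k where position \<open>length u\<close> lands, and the words around it,
  depend on \<sigma> but not on the letter p. This reduces multilinearity of \<open>perm_sum\<close>
  to each summand.\<close>

lemma permuted_split:
  assumes "\<sigma> permutes {..<Suc (length u + length w)}"
  obtains a b where "set a \<subseteq> set u \<union> set w" "set b \<subseteq> set u \<union> set w"
    "\<And>p. map (\<lambda>i. (u @ p # w) ! \<sigma> i) [0..<Suc (length u + length w)] = a @ p # b"
proof -
  let ?n = "Suc (length u + length w)"
  obtain k where k: "k < ?n" "\<sigma> k = length u"
    using permutes_image[OF assms] by (metis imageE lessThan_iff less_add_Suc1)
  have uniq: "\<sigma> i = length u \<longleftrightarrow> i = k" for i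
    using k(2) permutes_inj[OF assms] by (metis inj_eq)
  \<comment> \<open>\<open>undefined\<close> only holds the place of the letter p; the index k is
    left out of \<open>a\<close> and \<open>b\<close>, so it is never read.\<close>
  define a where "a = map (\<lambda>i. (u @ undefined # w) ! \<sigma> i) [0..<k]"
  define b where "b = map (\<lambda>i. (u @ undefined # w) ! \<sigma> i) [Suc k..<?n]"
  have nth: "(u @ p # w) ! \<sigma> i = (u @ undefined # w) ! \<sigma> i" if "i \<noteq> k" for i p
    using uniq[of i] that by (auto simp: nth_append nth_Cons split: nat.splits)
  have mem: "(u @ undefined # w) ! \<sigma> i \<in> set u \<union> set w" if "i \<noteq> k" "i < ?n" for i
  proof -
    have "\<sigma> i < ?n" using permutes_in_image[OF assms, of i] that by simp
    then show ?thesis using uniq[of i] that by (auto simp: nth_append nth_Cons split: nat.splits)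
  qed
  have split: "[0..<?n] = [0..<k] @ k # [Suc k..<?n]"
    using upt_add_eq_append[of 0 k "?n - k"] k(1) by (simp add: upt_conv_Cons del: upt_Suc)
  show ?thesis
  proof (rule that[of a b])
    show "set a \<subseteq> set u \<union> set w"
      unfolding a_def set_map using mem k(1) by (intro image_subsetI) (simp del: upt_Suc)
    show "set b \<subseteq> set u \<union> set w"
      unfolding b_def set_map using mem by (intro image_subsetI) (simp del: upt_Suc)
    fix p
    show "map (\<lambda>i. (u @ p # w) ! \<sigma> i) [0..<?n] = a @ p # b"
      unfolding split a_def b_def
      by (simp only: map_append list.map, intro arg_cong2[where f = append] arg_cong2[where f = Cons] map_cong refl nth)
         (simp_all add: k(2) del: upt_Suc)
  qed
qed

text \<open>Each summand is the given relation between words a and b that are common to its three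
  terms. As in \<open>wick_linear\<close>, two coefficients cover sums and multiples.\<close>

lemma perm_sum_linear:
  assumes "set u \<subseteq> V" "set w \<subseteq> V"
    and "wd [p] - (scal \<alpha> * wd [q] + scal \<beta> * wd [r]) \<in> tideal V R"
  shows "perm_sum (u @ p # w) - (scal \<alpha> * perm_sum (u @ q # w) + scal \<beta> * perm_sum (u @ r # w)) \<in> tideal V R"
proof -
  let ?n = "Suc (length u + length w)"
  have "wd (map (\<lambda>i. (u @ p # w) ! \<sigma> i) [0..<?n])
      - (scal \<alpha> * wd (map (\<lambda>i. (u @ q # w) ! \<sigma> i) [0..<?n])
         + scal \<beta> * wd (map (\<lambda>i. (u @ r # w) ! \<sigma> i) [0..<?n])) \<in> tideal V R"
    if \<sigma>: "\<sigma> permutes {..<?n}" for \<sigma>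
  proof -
    obtain a b where ab: "set a \<subseteq> set u \<union> set w" "set b \<subseteq> set u \<union> set w"
      and eq: "\<And>p. map (\<lambda>i. (u @ p # w) ! \<sigma> i) [0..<?n] = a @ p # b"
      using permuted_split[OF \<sigma>] by metis
    have "wd (a @ p # b) - (scal \<alpha> * wd (a @ q # b) + scal \<beta> * wd (a @ r # b)) =
        wd a * (wd [p] - (scal \<alpha> * wd [q] + scal \<beta> * wd [r])) * wd b"
      by (simp add: wd_append wd_Cons[of _ b] algebra_simps scal_left_commute)
    moreover have "\<dots> \<in> tideal V R"
      using ab assms by (intro tideal_wd_left tideal_wd_right) auto
    ultimately show ?thesis unfolding eq by simp
  qed
  then have "(\<Sum>\<sigma>\<in>{\<sigma>. \<sigma> permutes {..<?n}}. wd (map (\<lambda>i. (u @ p # w) ! \<sigma> i) [0..<?n])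
      - (scal \<alpha> * wd (map (\<lambda>i. (u @ q # w) ! \<sigma> i) [0..<?n])
         + scal \<beta> * wd (map (\<lambda>i. (u @ r # w) ! \<sigma> i) [0..<?n]))) \<in> tideal V R"
    by (intro tideal_sum) simp
  then show ?thesis
    by (simp add: perm_sum_def sum_subtractf sum.distrib sum_distrib_left del: upt_Suc)
qed

text \<open>Commutators are annihilated exactly, by \<open>perm_sum_swap\<close>, so only linearity
  relations survive. The resulting ideal lies in the Weyl ideal of every \<omega>, which makes
  symmetrization well defined.\<close>

lemma symz_sym_ideal:
  fixes s :: "'k::field_char_0 \<Rightarrow> 'v::ab_group_add \<Rightarrow> 'v"
  assumes "f \<in> tideal V (lin_rel s V \<union> com_rel V (\<lambda>_ _. 0))"
  shows "symz f \<in> tideal V (lin_rel s V)"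
  unfolding symz_def using assms
proof (rule lext_tideal)
  fix us ws :: "'v list" and r :: "'v word \<Rightarrow>\<^sub>0 'k"
  let ?h = "\<lambda>vs. scal (inverse (fact (length vs))) * perm_sum vs :: 'v word \<Rightarrow>\<^sub>0 'k"
  assume us: "set us \<subseteq> V" "set ws \<subseteq> V" and "r \<in> lin_rel s V \<union> com_rel V (\<lambda>_ _. 0)"
  then consider
      (add) v w where "r = wd [v + w] - (wd [v] + wd [w])" "v \<in> V" "w \<in> V"
    | (scale) c v where "r = wd [s c v] - scal c * wd [v]" "v \<in> V"
    | (com) v w where "r = wd [v, w] - wd [w, v]" "v \<in> V" "w \<in> V"
    by (auto simp: lin_rel_def com_rel_def)
  then show "lext ?h (wd us * r * wd ws) \<in> tideal V (lin_rel s V)"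
  proof cases
    case add
    have "wd us * r * wd ws = wd (us @ (v + w) # ws) - (wd (us @ v # ws) + wd (us @ w # ws))"
      by (simp add: add wd_append wd_Cons[of _ ws] algebra_simps)
    then have "lext ?h (wd us * r * wd ws) = scal (inverse (fact (Suc (length us + length ws)))) *
        (perm_sum (us @ (v + w) # ws) - (scal 1 * perm_sum (us @ v # ws) + scal 1 * perm_sum (us @ w # ws)))"
      by (simp add: lext_add lext_diff right_diff_distrib distrib_left del: fact_Suc)
    moreover have "r \<in> tideal V (lin_rel s V)"
      using add by (auto simp: lin_rel_def intro!: tideal_incl)
    ultimately show ?thesis
      using us perm_sum_linear[of us V ws "v + w" 1 v 1 w "lin_rel s V"] add by (simp add: tideal_scal del: fact_Suc)
  next
    case scale
    have "wd us * r * wd ws = wd (us @ s c v # ws) - scal c * wd (us @ v # ws)"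
      by (simp add: scale wd_append wd_Cons[of _ ws] algebra_simps scal_left_commute)
    then have "lext ?h (wd us * r * wd ws) = scal (inverse (fact (Suc (length us + length ws)))) *
        (perm_sum (us @ s c v # ws) - (scal c * perm_sum (us @ v # ws) + scal 0 * perm_sum (us @ v # ws)))"
      by (simp add: lext_diff lext_scal right_diff_distrib scal_left_commute[of "scal c" "inverse _"] del: fact_Suc)
    moreover have "r \<in> tideal V (lin_rel s V)"
      using scale by (auto simp: lin_rel_def intro!: tideal_incl)
    ultimately show ?thesis
      using us perm_sum_linear[of us V ws "s c v" c v 0 v "lin_rel s V"] scale by (simp add: tideal_scal del: fact_Suc)
  next
    case com
    have "wd us * r * wd ws = wd (us @ v # w # ws) - wd (us @ w # v # ws)"
      by (simp add: com wd_append wd_Cons[of _ "_ # ws"] wd_Cons[of _ ws] wd_Cons[of _ "[_]"] algebra_simps)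
    then show ?thesis
      by (simp add: lext_diff perm_sum_swap[of us v w ws] tideal.zero)
  qed
qed

text \<open>Adjacent swaps generate all rearrangements: the first letter of one list is located in
  the other and moved there past its neighbours, while an already matched prefix \<open>p\<close>
  stays fixed.\<close>

lemma mset_swap_induct [consumes 1, case_names refl trans swap]:
  assumes "mset xs = mset ys"
    and refl: "\<And>xs. P xs xs" and trans: "\<And>xs ys zs. P xs ys \<Longrightarrow> P ys zs \<Longrightarrow> P xs zs"
    and swap: "\<And>u x y w. P (u @ x # y # w) (u @ y # x # w)"
  shows "P xs ys"
proof -
  have move: "P (p @ a # u @ w) (p @ u @ a # w)" for p u w a
  proof (induction u arbitrary: p)
    case Nil
    then show ?case by (simp add: refl)
  next
    case (Cons b u)
    show ?case using trans[OF swap Cons[of "p @ [b]", simplified]] by simp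
  qed
  have "P (p @ xs) (p @ ys)" for p
    using assms(1)
  proof (induction xs arbitrary: ys p)
    case Nil
    then show ?case by (simp add: refl)
  next
    case (Cons a xs)
    then have "a \<in> set ys" by (metis list.set_intros(1) set_mset_mset)
    then obtain u w where ys: "ys = u @ a # w" by (auto dest: split_list)
    then have "mset xs = mset (u @ w)" using Cons.prems by simp
    from trans[OF Cons.IH[OF this, of "p @ [a]", simplified] move] show ?case by (simp add: ys)
  qed
  from this[of "[]"] show ?thesis by simp
qed

text \<open>Modulo the Weyl relations a word differs from each of its rearrangements by shorter
  words, hence also from their average, which is its symmetrization. Induction on length
  finishes.\<close>

lemma symz_surj:
  fixes s :: "'k::field_char_0 \<Rightarrow> 'v::ab_group_add \<Rightarrow> 'v"
  assumes "f \<in> free_carrier V"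
  shows "\<exists>g\<in>free_carrier V. symz g - f \<in> tideal V (lin_rel s V \<union> com_rel V \<omega>)"
proof -
  define J where "J = tideal V (lin_rel s V \<union> com_rel V \<omega>)"
  \<comment> \<open>The polynomials whose Weyl class is a symmetrization; a subspace containing the
    ideal.\<close>
  define M where "M = {f. \<exists>g\<in>free_carrier V. symz g - f \<in> J}"
  have M_add: "f + g \<in> M" if "f \<in> M" "g \<in> M" for f g
  proof -
    from that obtain f' g' where "f' \<in> free_carrier V" "g' \<in> free_carrier V" "symz f' - f \<in> J" "symz g' - g \<in> J"
      by (auto simp: M_def)
    then have "symz (f' + g') - (f + g) \<in> J"
      using tideal_add[of "symz f' - f" V _ "symz g' - g"] by (simp add: J_def symz_def lext_add algebra_simps)
    then show ?thesis using \<open>f' \<in> _\<close> \<open>g' \<in> _\<close> by (auto simp: M_def intro!: bexI[of _ "f' + g'"])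
  qed
  have M_scal: "scal c * f \<in> M" if "f \<in> M" for f c
  proof -
    from that obtain f' where "f' \<in> free_carrier V" "symz f' - f \<in> J" by (auto simp: M_def)
    then have "symz (scal c * f') - scal c * f \<in> J"
      using tideal_scal[of "symz f' - f" V _ c] by (simp add: J_def symz_def lext_scal algebra_simps)
    then show ?thesis using \<open>f' \<in> _\<close> by (auto simp: M_def intro!: bexI[of _ "scal c * f'"])
  qed
  have M_0: "0 \<in> M"
    by (auto simp: M_def J_def symz_def intro!: bexI[of _ 0] tideal.zero)
  have M_J: "f \<in> M" if "f \<in> J" for f
    using tideal_uminus[of f] that by (auto simp: M_def J_def symz_def intro!: bexI[of _ 0])
  have M_sum: "sum h I \<in> M" if "\<And>i. i \<in> I \<Longrightarrow> h i \<in> M" for h :: "'i \<Rightarrow> 'v word \<Rightarrow>\<^sub>0 'k" and I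
    using that by (induction I rule: infinite_finite_induct) (auto simp: M_0 M_add)
  have words: "wd us \<in> M" if "set us \<subseteq> V" for us
    using that
  proof (induction "length us" arbitrary: us rule: less_induct)
    case less
    let ?P = "{\<sigma>. \<sigma> permutes {..<length us}}" and ?w = "\<lambda>\<sigma>. map (\<lambda>i. us ! \<sigma> i) [0..<length us]"
    \<comment> \<open>The hypotheses on letters and length reappear in the conclusion so that the
      property is transitive; the length lets the outer induction handle the word left after a
      commutator, which is shorter by two.\<close>
    have perm: "set xs \<subseteq> V \<and> length xs = length us \<longrightarrow>
        set ys \<subseteq> V \<and> length ys = length us \<and> wd xs - wd ys \<in> M" if "mset xs = mset ys" for xs ys
      using that
    proof (induction rule: mset_swap_induct)
      case (refl xs)
      then show ?case using M_0 by simp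
    next
      case (trans xs ys zs)
      then show ?case using M_add[of "wd xs - wd ys" "wd ys - wd zs"] by simp
    next
      case (swap u x y w)
      show ?case
      proof (intro impI conjI)
        assume V: "set (u @ x # y # w) \<subseteq> V \<and> length (u @ x # y # w) = length us"
        then show "set (u @ y # x # w) \<subseteq> V" "length (u @ y # x # w) = length us" by auto
        have "wd [x, y] - wd [y, x] - scal (\<omega> x y) \<in> J"
          unfolding J_def using V by (intro tideal_incl) (auto simp: com_rel_def)
        then have "wd u * (wd [x, y] - wd [y, x] - scal (\<omega> x y)) * wd w \<in> J"
          using V unfolding J_def by (intro tideal_wd_left tideal_wd_right) auto
        moreover have "wd u * (wd [x, y] - wd [y, x] - scal (\<omega> x y)) * wd w =
            wd (u @ x # y # w) - wd (u @ y # x # w) - scal (\<omega> x y) * wd (u @ w)"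
          by (simp add: wd_append wd_Cons[of _ "_ # w"] wd_Cons[of _ w] wd_Cons[of _ "[_]"]
              algebra_simps scal_left_commute flip: scal_commute)
        ultimately have "wd (u @ x # y # w) - wd (u @ y # x # w) - scal (\<omega> x y) * wd (u @ w) \<in> M"
          using M_J by simp
        moreover have "scal (\<omega> x y) * wd (u @ w) \<in> M"
          using V by (intro M_scal less(1)) auto
        ultimately show "wd (u @ x # y # w) - wd (u @ y # x # w) \<in> M"
          using M_add by fastforce
      qed
    qed
    \<comment> \<open>Averaged differences plus the average itself give back the word, there being
      n! permutations.\<close>
    have "scal (inverse (fact (length us))) * (\<Sum>\<sigma>\<in>?P. wd us - wd (?w \<sigma>)) \<in> M"
    proof (intro M_scal M_sum)
      fix \<sigma> assume "\<sigma> \<in> ?P"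
      then show "wd us - wd (?w \<sigma>) \<in> M"
        using perm[of us "?w \<sigma>"] mset_permuted[of \<sigma> us] less.prems by auto
    qed
    moreover have "symz (wd us) \<in> M"
      using less.prems by (auto simp: M_def J_def intro!: bexI[of _ "wd us"] tideal.zero)
    ultimately have "scal (inverse (fact (length us))) * (\<Sum>\<sigma>\<in>?P. wd us - wd (?w \<sigma>)) + symz (wd us) \<in> M"
      by (rule M_add)
    also have "scal (inverse (fact (length us))) * (\<Sum>\<sigma>\<in>?P. wd us - wd (?w \<sigma>)) + symz (wd us) =
        scal (inverse (fact (length us))) * (of_nat (fact (length us)) * wd us)"
      by (simp add: symz_def perm_sum_def sum_subtractf right_diff_distrib card_permutations[OF refl])
    also have "\<dots> = scal (inverse (fact (length us)) * fact (length us)) * wd us"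
      by (simp only: scal_mult mult.assoc of_nat_fact flip: single_of_nat)
    finally show ?case by simp
  qed
  have "f \<in> M"
    using assms by (induction rule: free_induct) (auto intro: M_0 M_add M_scal words)
  then show ?thesis by (simp add: M_def J_def)
qed


text \<open>The map induced by \<open>symz\<close> witnesses the \<open>SOME\<close>, and linear
  maps agreeing on words agree everywhere, so whatever is selected coincides with it.\<close>

lemma symmetrization_spec:
  fixes s :: "'k::field_char_0 \<Rightarrow> 'v::ab_group_add \<Rightarrow> 'v"
  assumes "linear_closed s V"
  shows "symmetrization s V \<omega> \<in> linear_maps (sym_alg s V) (weyl_alg s V \<omega>)"
    and "f \<in> free_carrier V \<Longrightarrow> symmetrization s V \<omega> (quot_cls s V (sym_ideal s V) f) =
      quot_cls s V (weyl_ideal s V \<omega>) (symz f)"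
proof -
  interpret linear_closed s V by fact
  let ?S = "sym_alg s V" and ?W = "weyl_alg s V \<omega>"
  let ?qS = "quot_cls s V (sym_ideal s V)" and ?qW = "quot_cls s V (weyl_ideal s V \<omega>)"
  interpret S: presentation V "tideal V (lin_rel s V \<union> com_rel V (\<lambda>_ _. 0))" ?S ?qS
    by (rule presentation_sym)
  interpret W: presentation V "tideal V (lin_rel s V \<union> com_rel V \<omega>)" ?W ?qW
    by (rule presentation_weyl)
  interpret WR: ring ?W by (rule W.ring_A)
  define P where "P Q \<longleftrightarrow> Q \<in> linear_maps ?S ?W \<and>
       (\<forall>vs. set vs \<subseteq> V \<longrightarrow>
          Q (list_prod ?S (map (sym_gen s V) vs)) =
            inverse (fact (length vs)) \<odot>\<^bsub>?W\<^esub>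
              (\<Oplus>\<^bsub>?W\<^esub>\<sigma>\<in>{\<sigma>. \<sigma> permutes {..<length vs}}.
                 list_prod ?W (map (\<lambda>i. weyl_gen s V \<omega> (vs ! \<sigma> i)) [0..<length vs])))" for Q
  have L: "list_prod ?S (map (sym_gen s V) vs) = ?qS (wd vs)" if "set vs \<subseteq> V" for vs
    using that by (simp add: S.q_wd sym_gen_eq[abs_def])
  have R: "inverse (fact (length vs)) \<odot>\<^bsub>?W\<^esub>
        (\<Oplus>\<^bsub>?W\<^esub>\<sigma>\<in>{\<sigma>. \<sigma> permutes {..<length vs}}.
          list_prod ?W (map (\<lambda>i. weyl_gen s V \<omega> (vs ! \<sigma> i)) [0..<length vs])) = ?qW (symz (wd vs))"
    if vs: "set vs \<subseteq> V" for vs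
  proof -
    have V: "set (map (\<lambda>i. vs ! \<sigma> i) [0..<length vs]) \<subseteq> V" if "\<sigma> permutes {..<length vs}" for \<sigma>
      using permuted_letters[OF that] vs by simp
    have "?qW (perm_sum vs) = (\<Oplus>\<^bsub>?W\<^esub>\<sigma>\<in>{\<sigma>. \<sigma> permutes {..<length vs}}.
        ?qW (wd (map (\<lambda>i. vs ! \<sigma> i) [0..<length vs])))"
      unfolding perm_sum_def by (rule W.q_sum) (use V in \<open>auto simp: finite_permutations intro!: wd_in_free\<close>)
    also have "\<dots> = (\<Oplus>\<^bsub>?W\<^esub>\<sigma>\<in>{\<sigma>. \<sigma> permutes {..<length vs}}.
          list_prod ?W (map (\<lambda>i. weyl_gen s V \<omega> (vs ! \<sigma> i)) [0..<length vs]))"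
    proof (rule WR.finsum_cong'[OF refl])
      have eq: "list_prod ?W (map (\<lambda>i. weyl_gen s V \<omega> (vs ! \<sigma> i)) [0..<length vs]) =
          ?qW (wd (map (\<lambda>i. vs ! \<sigma> i) [0..<length vs]))" if "\<sigma> permutes {..<length vs}" for \<sigma>
        using W.q_wd[OF V[OF that]] by (simp add: weyl_gen_eq comp_def)
      then show "?qW (wd (map (\<lambda>i. vs ! \<sigma> i) [0..<length vs])) =
          list_prod ?W (map (\<lambda>i. weyl_gen s V \<omega> (vs ! \<sigma> i)) [0..<length vs])"
        if "\<sigma> \<in> {\<sigma>. \<sigma> permutes {..<length vs}}" for \<sigma>
        using that by simp
      show "(\<lambda>\<sigma>. list_prod ?W (map (\<lambda>i. weyl_gen s V \<omega> (vs ! \<sigma> i)) [0..<length vs]))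
          \<in> {\<sigma>. \<sigma> permutes {..<length vs}} \<rightarrow> carrier ?W"
        using eq V by (auto intro!: W.q_in wd_in_free)
    qed
    finally show ?thesis
      using W.q_smult[OF perm_sum_in_free[OF vs], of "inverse (fact (length vs))"]
      by (simp add: symz_def)
  qed
  obtain Q where Q: "Q \<in> linear_maps ?S ?W" "\<And>f. f \<in> free_carrier V \<Longrightarrow> Q (?qS f) = ?qW (symz f)"
  proof (rule presentation_induced[OF presentation_sym presentation_weyl, where T = symz])
    show "symz (f + g) = symz f + symz g" "symz (scal c * f) = scal c * symz f"
      for f g :: "'v word \<Rightarrow>\<^sub>0 'k" and c by (simp_all add: symz_def lext_add lext_scal)
    show "symz f \<in> tideal V (lin_rel s V \<union> com_rel V \<omega>)"
      if "f \<in> tideal V (lin_rel s V \<union> com_rel V (\<lambda>_ _. 0))" for f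
      using symz_sym_ideal[OF that] by (rule tideal_mono) (auto intro: tideal_incl)
  qed (auto simp: symz_in_free)
  have "P Q" using Q L R by (simp add: P_def)
  moreover have "symmetrization s V \<omega> = (SOME Q. P Q)"
    unfolding symmetrization_def Let_def P_def by (rule refl)
  ultimately have P: "P (symmetrization s V \<omega>)" by (simp only: someI[of P])
  then show lin: "symmetrization s V \<omega> \<in> linear_maps ?S ?W" unfolding P_def by (rule conjunct1)
  assume f: "f \<in> free_carrier V"
  have "symmetrization s V \<omega> (?qS f) = Q (?qS f)"
    using lin Q(1) _ f
  proof (rule S.linear_maps_eqI)
    fix us assume "set us \<subseteq> V"
    then show "symmetrization s V \<omega> (?qS (wd us)) = Q (?qS (wd us))"
      using P L R Q(2) by (simp add: P_def)
  qed
  then show "symmetrization s V \<omega> (?qS f) = ?qW (symz f)" using Q(2) f by simp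
qed

text \<open>By \<open>symz_surj\<close> the class of \<open>f\<close> has a preimage under
  symmetrization, so \<open>inv_into\<close> returns a genuine one; \<open>g\<close> represents the
  one it returns.\<close>

lemma eta_symz:
  fixes s :: "'k::field_char_0 \<Rightarrow> 'v::ab_group_add \<Rightarrow> 'v"
  assumes "linear_closed s V" and f: "f \<in> free_carrier V"
  obtains g where "g \<in> free_carrier V" "symz g - f \<in> tideal V (lin_rel s V \<union> com_rel V \<omega>)"
    "eta s V \<omega> (quot_cls s V (weyl_ideal s V \<omega>) f) = quot_cls s V (sym_ideal s V) g"
proof -
  interpret linear_closed s V by fact
  let ?qS = "quot_cls s V (sym_ideal s V)" and ?qW = "quot_cls s V (weyl_ideal s V \<omega>)"
  let ?Q = "symmetrization s V \<omega>"
  interpret S: presentation V "tideal V (lin_rel s V \<union> com_rel V (\<lambda>_ _. 0))" "sym_alg s V" ?qS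
    by (rule presentation_sym)
  interpret W: presentation V "tideal V (lin_rel s V \<union> com_rel V \<omega>)" "weyl_alg s V \<omega>" ?qW
    by (rule presentation_weyl)
  note spec = symmetrization_spec(2)[OF assms(1), where \<omega> = \<omega>]
  obtain g where g: "g \<in> free_carrier V" "symz g - f \<in> tideal V (lin_rel s V \<union> com_rel V \<omega>)"
    using symz_surj[OF f] by blast
  then have "?Q (?qS g) = ?qW f" using W.ker f by (simp add: spec symz_in_free)
  then have im: "?qW f \<in> ?Q ` carrier (sym_alg s V)" using g(1) by (metis S.q_in imageI)
  define e where "e = eta s V \<omega> (?qW f)"
  have "e \<in> carrier (sym_alg s V)" "?Q e = ?qW f"
    using im by (simp_all add: e_def eta_def inv_into_into f_inv_into_f)
  moreover obtain h where h: "h \<in> free_carrier V" "e = ?qS h"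
    using \<open>e \<in> _\<close> by (rule S.carrierE)
  ultimately have "symz h - f \<in> tideal V (lin_rel s V \<union> com_rel V \<omega>)"
    using W.ker f by (simp add: spec symz_in_free)
  with h show ?thesis unfolding e_def by (intro that)
qed

section \<open>Homogeneous components\<close>

definition hom_part :: "nat \<Rightarrow> ('v word \<Rightarrow>\<^sub>0 'k::field) \<Rightarrow> ('v word \<Rightarrow>\<^sub>0 'k)" where
  "hom_part d = lext (\<lambda>us. if length us = d then wd us else 0)"

lemma lext_wd_id: "lext wd f = f"
proof (induction rule: free_induct[OF in_free_UNIV[of f]])
  case (2 c us f)
  then show ?case by (simp add: lext_add lext_scal)
qed simp

lemma hom_part_homogeneous:
  assumes "\<forall>u\<in>Poly_Mapping.keys f. length (letters u) = i"
  shows "hom_part d f = (if i = d then f else 0)"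
proof -
  have "hom_part d f = (if i = d then lext wd f else 0)"
    using assms by (auto simp: hom_part_def lext_def intro!: sum.cong sum.neutral)
  then show ?thesis by (simp add: lext_wd_id)
qed

lemma hom_part_in_free: "f \<in> free_carrier V \<Longrightarrow> hom_part d f \<in> free_carrier V"
  unfolding hom_part_def by (rule lext_in_free) auto

lemma keys_hom_part: "\<forall>u\<in>Poly_Mapping.keys (hom_part d f). length (letters u) = d"
proof (induction rule: free_induct[OF in_free_UNIV[of f]])
  case (2 c us f)
  define a :: "'a word \<Rightarrow>\<^sub>0 'b" where "a = (if length us = d then scal c * wd us else 0)"
  have "hom_part d (scal c * wd us + f) = a + hom_part d f"
    by (simp add: hom_part_def lext_add lext_scal a_def)
  moreover have "\<forall>u\<in>Poly_Mapping.keys a. length (letters u) = d"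
    by (simp add: scal_wd a_def)
  ultimately show ?case using 2(3) Poly_Mapping.keys_add[of a "hom_part d f"] by auto
qed (simp add: hom_part_def)

lemma hom_part_decompose:
  fixes f :: "'v word \<Rightarrow>\<^sub>0 'k::field"
  obtains n where "\<And>i. i > n \<Longrightarrow> hom_part i f = 0" "f = (\<Sum>i\<le>n. hom_part i f)"
proof -
  \<comment> \<open>The inserted 0 keeps the set nonempty when f = 0.\<close>
  define n where "n = Max (insert 0 ((\<lambda>u. length (letters u)) ` Poly_Mapping.keys f))"
  have n: "length (letters u) \<le> n" if "u \<in> Poly_Mapping.keys f" for u
    unfolding n_def using that by (intro Max_ge) auto
  have "hom_part i f = 0" if "i > n" for i
    using n that by (fastforce simp: hom_part_def lext_def intro!: sum.neutral)
  moreover have "(\<Sum>i\<le>n. hom_part i f) = lext wd f"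
    unfolding hom_part_def lext_def
    by (subst sum.swap) (use n in \<open>auto intro!: sum.cong simp flip: sum_distrib_left\<close>)
  ultimately show ?thesis using that[of n] by (simp add: lext_wd_id)
qed

text \<open>The relations of the symmetric algebra are homogeneous, so a relation between two words
  is either kept or killed by \<open>hom_part\<close>.\<close>

lemma hom_part_sym_ideal:
  fixes s :: "'k::field \<Rightarrow> 'v::ab_group_add \<Rightarrow> 'v"
  assumes "f \<in> tideal V (lin_rel s V \<union> com_rel V (\<lambda>_ _. 0))"
  shows "hom_part d f \<in> tideal V (lin_rel s V \<union> com_rel V (\<lambda>_ _. 0))"
  unfolding hom_part_def using assms
proof (rule lext_tideal)
  fix us ws :: "'v list" and r :: "'v word \<Rightarrow>\<^sub>0 'k"
  let ?R = "lin_rel s V \<union> com_rel V (\<lambda>_ _. 0)"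
  assume us: "set us \<subseteq> V" "set ws \<subseteq> V" and r: "r \<in> ?R"
  obtain i where "\<forall>u\<in>Poly_Mapping.keys r. length (letters u) = i"
  proof -
    \<comment> \<open>Linearity relations have degree 1 and commutators degree 2.\<close>
    have "hom_part 1 r = r \<or> hom_part 2 r = r"
      using r by (auto simp: lin_rel_def com_rel_def hom_part_def lext_diff lext_add lext_scal)
    then show thesis using that keys_hom_part by metis
  qed
  then have "\<forall>u\<in>Poly_Mapping.keys (wd us * r * wd ws). length (letters u) = length us + i + length ws"
    using Poly_Mapping.keys_mult[of "wd us * r" "wd ws"] Poly_Mapping.keys_mult[of "wd us" r]
    by (fastforce simp: wd_def plus_word_def)
  from hom_part_homogeneous[OF this, of d]
  show "lext (\<lambda>us. if length us = d then wd us else 0) (wd us * r * wd ws) \<in> tideal V ?R"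
    using tideal_word[OF us r] by (simp add: hom_part_def tideal.zero)
qed

text \<open>Decomposing a representative gives existence for the \<open>THE\<close>; uniqueness is
  the homogeneity of the ideal.\<close>

lemma sym_component_eq:
  fixes s :: "'k::field \<Rightarrow> 'v::ab_group_add \<Rightarrow> 'v"
  assumes "linear_closed s V" and g: "g \<in> free_carrier V"
  shows "sym_component s V d (quot_cls s V (sym_ideal s V) g) = quot_cls s V (sym_ideal s V) (hom_part d g)"
proof -
  interpret linear_closed s V by fact
  let ?S = "sym_alg s V" and ?q = "quot_cls s V (sym_ideal s V)"
  let ?J = "tideal V (lin_rel s V \<union> com_rel V (\<lambda>_ _. 0))"
  interpret S: presentation V ?J ?S ?q by (rule presentation_sym)
  show ?thesis unfolding sym_component_def Let_def
  proof (rule the_equality)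
    obtain n where "\<And>i. i > n \<Longrightarrow> hom_part i g = 0" and n: "g = (\<Sum>i\<le>n. hom_part i g)"
      using hom_part_decompose by blast
    moreover have "?q g = (\<Oplus>\<^bsub>?S\<^esub>i\<in>{..n}. ?q (hom_part i g))"
      by (subst n, rule S.q_sum) (simp_all add: hom_part_in_free g)
    ultimately show "\<exists>c n. (\<forall>i. c i \<in> sym_power s V i) \<and> (\<forall>i>n. c i = \<zero>\<^bsub>?S\<^esub>) \<and>
        ?q g = (\<Oplus>\<^bsub>?S\<^esub>i\<in>{..n}. c i) \<and> ?q (hom_part d g) = c d"
      using g by (intro exI[of _ "\<lambda>i. ?q (hom_part i g)"] exI[of _ n])
        (auto simp: sym_power_eq S.q_zero hom_part_in_free keys_hom_part)
  next
    fix x assume "\<exists>c n. (\<forall>i. c i \<in> sym_power s V i) \<and> (\<forall>i>n. c i = \<zero>\<^bsub>?S\<^esub>) \<and>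
        ?q g = (\<Oplus>\<^bsub>?S\<^esub>i\<in>{..n}. c i) \<and> x = c d"
    then obtain c n where c: "\<And>i. c i \<in> sym_power s V i" "\<And>i. i > n \<Longrightarrow> c i = \<zero>\<^bsub>?S\<^esub>"
      "?q g = (\<Oplus>\<^bsub>?S\<^esub>i\<in>{..n}. c i)" "x = c d" by blast
    have "\<exists>f. c i = ?q f \<and> f \<in> free_carrier V \<and> (\<forall>u\<in>Poly_Mapping.keys f. length (letters u) = i)" for i
      using c(1)[of i] unfolding sym_power_eq by blast
    then obtain f where f: "\<And>i. c i = ?q (f i)" "\<And>i. f i \<in> free_carrier V"
      "\<And>i. \<forall>u\<in>Poly_Mapping.keys (f i). length (letters u) = i" by metis
    have "?q g = ?q (\<Sum>i\<le>n. f i)"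
      using c(3) f S.q_sum[of "{..n}" f] by simp
    then have "g - (\<Sum>i\<le>n. f i) \<in> ?J" using S.ker g f(2) by simp
    then have "hom_part d (g - (\<Sum>i\<le>n. f i)) \<in> ?J" by (rule hom_part_sym_ideal)
    moreover have "hom_part d (\<Sum>i\<le>n. f i) = (\<Sum>i\<le>n. hom_part d (f i))"
      by (simp add: hom_part_def lext_sum)
    \<comment> \<open>Beyond \<open>n\<close> the component of the competing decomposition is zero,
      hence the case distinction.\<close>
    ultimately have J: "hom_part d g - (if d \<le> n then f d else 0) \<in> ?J"
      using hom_part_homogeneous[OF f(3), of d] by (simp add: hom_part_def lext_diff)
    have "?q (hom_part d g) = ?q (if d \<le> n then f d else 0)"
      using J g f(2) by (subst S.ker) (auto simp: hom_part_in_free)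
    then show "x = ?q (hom_part d g)"
      using c(2)[of d] c(4) f(1) by (auto simp: S.q_zero split: if_splits)
  qed
qed

section \<open>The Wick functional on the Weyl algebra\<close>

definition wick_ext ::
  "('v \<Rightarrow> 'v \<Rightarrow> 'k::field) \<Rightarrow> ('v \<Rightarrow> 'k) \<Rightarrow> nat \<Rightarrow> ('v word \<Rightarrow>\<^sub>0 'k) \<Rightarrow> ('v word \<Rightarrow>\<^sub>0 'k)" where
  "wick_ext \<omega> \<xi> d = lext (\<lambda>us. scal (wick \<omega> \<xi> d us))"

text \<open>Linearity relations vanish by \<open>wick_linear\<close> and commutation relations by
  \<open>wick_swap\<close>. Linearity of \<omega> in its first argument is drawn from the second by
  antisymmetry.\<close>

lemma wick_ext_weyl_ideal:
  fixes s :: "'k::field_char_0 \<Rightarrow> 'v::ab_group_add \<Rightarrow> 'v"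
  assumes anti: "\<And>x y. \<omega> y x = - \<omega> x y"
    and add: "\<And>a v w. a \<in> V \<Longrightarrow> v \<in> V \<Longrightarrow> w \<in> V \<Longrightarrow> \<omega> a (v + w) = \<omega> a v + \<omega> a w"
    and scale: "\<And>c a v. a \<in> V \<Longrightarrow> v \<in> V \<Longrightarrow> \<omega> a (s c v) = c * \<omega> a v"
    and xi_add: "\<And>v w. v \<in> V \<Longrightarrow> w \<in> V \<Longrightarrow> \<xi> (v + w) = \<xi> v + \<xi> w"
    and xi_scale: "\<And>c v. v \<in> V \<Longrightarrow> \<xi> (s c v) = c * \<xi> v"
    and f: "f \<in> tideal V (lin_rel s V \<union> com_rel V \<omega>)"
  shows "wick_ext \<omega> \<xi> d f = 0"
proof -
  have "wick_ext \<omega> \<xi> d (wd us * r * wd ws) = 0"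
    if us: "set us \<subseteq> V" "set ws \<subseteq> V" and "r \<in> lin_rel s V \<union> com_rel V \<omega>" for us ws r
  proof -
    from that consider
      (add) v w where "r = wd [v + w] - (wd [v] + wd [w])" "v \<in> V" "w \<in> V"
    | (scale) c v where "r = wd [s c v] - scal c * wd [v]" "v \<in> V"
    | (com) v w where "r = wd [v, w] - wd [w, v] - scal (\<omega> v w)" "v \<in> V" "w \<in> V"
      by (auto simp: lin_rel_def com_rel_def)
    then show ?thesis
    proof cases
      case add
      have "wd us * r * wd ws = wd (us @ (v + w) # ws) - (wd (us @ v # ws) + wd (us @ w # ws))"
        by (simp add: add wd_append wd_Cons[of _ ws] algebra_simps)
      moreover have "\<omega> (v + w) a = \<omega> v a + \<omega> w a" if "a \<in> V" for a
        using assms(2)[of a v w] add that unfolding anti[of "v + w" a] anti[of v a] anti[of w a] by simp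
      then have "wick \<omega> \<xi> d (us @ (v + w) # ws) = 1 * wick \<omega> \<xi> d (us @ v # ws) + 1 * wick \<omega> \<xi> d (us @ w # ws)"
        using us add assms(2) xi_add by (intro wick_linear[where V = V]) auto
      ultimately show ?thesis
        by (simp add: wick_ext_def lext_diff lext_add single_add)
    next
      case scale
      have "wd us * r * wd ws = wd (us @ s c v # ws) - scal c * wd (us @ v # ws)"
        by (simp add: scale wd_append wd_Cons[of _ ws] algebra_simps scal_left_commute)
      moreover have "\<omega> (s c v) a = c * \<omega> v a" if "a \<in> V" for a
        using assms(3)[of a v c] scale that unfolding anti[of "s c v" a] anti[of v a] by simp
      then have "wick \<omega> \<xi> d (us @ s c v # ws) = c * wick \<omega> \<xi> d (us @ v # ws) + 0 * wick \<omega> \<xi> d (us @ v # ws)"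
        using us scale assms(3) xi_scale by (intro wick_linear[where V = V]) auto
      ultimately show ?thesis
        by (simp add: wick_ext_def lext_diff lext_scal scal_mult)
    next
      case com
      have "wd us * r * wd ws = wd (us @ v # w # ws) - wd (us @ w # v # ws) - scal (\<omega> v w) * wd (us @ ws)"
        by (simp add: com wd_append wd_Cons[of _ "_ # ws"] wd_Cons[of _ ws] wd_Cons[of _ "[_]"]
            algebra_simps scal_left_commute flip: scal_commute)
      then show ?thesis
        using wick_swap[of \<omega> \<xi> d us v w ws, OF anti]
        by (simp add: wick_ext_def lext_diff lext_scal scal_mult single_add)
    qed
  qed
  with f show ?thesis
    by (induction rule: tideal.induct) (simp_all add: wick_ext_def lext_add lext_scal)
qed

lemma wick_ext_perm_sum:
  fixes \<omega> :: "'v \<Rightarrow> 'v \<Rightarrow> 'k::field_char_0"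
  assumes "\<And>x y. \<omega> y x = - \<omega> x y" and "length us \<noteq> d"
  shows "wick_ext \<omega> \<xi> d (perm_sum us) = 0"
proof -
  have "wick_ext \<omega> \<xi> d (perm_sum us) = (\<Sum>\<sigma>\<in>{\<sigma>. \<sigma> permutes {..<length us}}.
      scal (wick \<omega> \<xi> d (map (\<lambda>i. us ! \<sigma> i) [0..<length us])))"
    by (simp add: wick_ext_def perm_sum_def lext_sum)
  also have "\<dots> = scal (\<Sum>\<sigma>\<in>{\<sigma>. \<sigma> permutes {..<length us}}.
      wick \<omega> \<xi> d (map (\<lambda>i. us ! \<sigma> i) [0..<length us]))"
    by (induction rule: infinite_finite_induct) (simp_all add: single_add)
  also have "\<dots> = 0" by (subst sum_permutations_wick[OF assms]) simp
  finally show ?thesis .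
qed

lemma wick_ext_symz_hom_part:
  fixes \<omega> :: "'v \<Rightarrow> 'v \<Rightarrow> 'k::field_char_0"
  assumes "\<And>x y. \<omega> y x = - \<omega> x y"
  shows "wick_ext \<omega> \<xi> d (symz (hom_part d f)) = wick_ext \<omega> \<xi> d (symz f)"
proof (induction rule: free_induct[OF in_free_UNIV[of f]])
  case 1
  then show ?case by (simp add: hom_part_def)
next
  case (2 c us f)
  have "wick_ext \<omega> \<xi> d (symz (wd us)) = 0" if "length us \<noteq> d"
    using wick_ext_perm_sum[of \<omega>, OF assms that]
    by (simp add: symz_def wick_ext_def lext_scal)
  with 2 show ?case
    by (simp add: hom_part_def symz_def wick_ext_def lext_add lext_scal)
qed

text \<open>Since \<open>wick_ext\<close> annihilates the Weyl ideal and only sees the degree \<open>d\<close> part of a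
  symmetrization, it detects the degree \<open>d\<close> component of \<open>eta\<close>.\<close>

lemma sym_component_eta_nonzero:
  fixes s :: "'k::field_char_0 \<Rightarrow> 'v::ab_group_add \<Rightarrow> 'v"
  assumes closed: "linear_closed s V"
    and anti: "\<And>x y. \<omega> y x = - \<omega> x y"
    and "\<And>a v w. a \<in> V \<Longrightarrow> v \<in> V \<Longrightarrow> w \<in> V \<Longrightarrow> \<omega> a (v + w) = \<omega> a v + \<omega> a w"
    and "\<And>c a v. a \<in> V \<Longrightarrow> v \<in> V \<Longrightarrow> \<omega> a (s c v) = c * \<omega> a v"
    and "\<And>v w. v \<in> V \<Longrightarrow> w \<in> V \<Longrightarrow> \<xi> (v + w) = \<xi> v + \<xi> w"
    and "\<And>c v. v \<in> V \<Longrightarrow> \<xi> (s c v) = c * \<xi> v"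
    and f: "f \<in> free_carrier V" and nz: "wick_ext \<omega> \<xi> d f \<noteq> 0"
  shows "sym_component s V d (eta s V \<omega> (quot_cls s V (weyl_ideal s V \<omega>) f)) \<noteq> \<zero>\<^bsub>sym_alg s V\<^esub>"
proof
  interpret linear_closed s V by fact
  let ?q = "quot_cls s V (sym_ideal s V)"
  interpret S: presentation V "tideal V (lin_rel s V \<union> com_rel V (\<lambda>_ _. 0))" "sym_alg s V" ?q
    by (rule presentation_sym)
  have kill: "wick_ext \<omega> \<xi> d h = 0" if "h \<in> tideal V (lin_rel s V \<union> com_rel V \<omega>)" for h
    using wick_ext_weyl_ideal[of \<omega>, OF assms(2-6) that] .
  obtain g where g: "g \<in> free_carrier V" "symz g - f \<in> tideal V (lin_rel s V \<union> com_rel V \<omega>)"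
    "eta s V \<omega> (quot_cls s V (weyl_ideal s V \<omega>) f) = ?q g"
    using eta_symz[OF closed f] .
  assume "sym_component s V d (eta s V \<omega> (quot_cls s V (weyl_ideal s V \<omega>) f)) = \<zero>\<^bsub>sym_alg s V\<^esub>"
  then have "?q (hom_part d g) = ?q 0"
    using g sym_component_eq[OF closed g(1)] by (simp add: S.q_zero)
  then have "hom_part d g \<in> tideal V (lin_rel s V \<union> com_rel V (\<lambda>_ _. 0))"
    using S.ker[of "hom_part d g" 0] g(1) by (simp add: hom_part_in_free)
  then have "symz (hom_part d g) \<in> tideal V (lin_rel s V \<union> com_rel V \<omega>)"
    by (rule tideal_mono[OF symz_sym_ideal]) (auto intro: tideal_incl)
  then have "wick_ext \<omega> \<xi> d (symz g) = 0"
    using kill wick_ext_symz_hom_part[of \<omega>, OF anti] by metis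
  moreover have "wick_ext \<omega> \<xi> d (symz g - f) = 0" using g(2) by (rule kill)
  ultimately show False using nz by (simp add: wick_ext_def lext_diff)
qed


section \<open>Graded quadratic Lie algebras\<close>

context lie_algebra
begin

sublocale br_right: module_hom scale scale "br x" for x
  using br_linear_right by (rule module_hom_linearI)

sublocale br_left: module_hom scale scale "\<lambda>x. br x y" for y
  using br_linear_left by (rule module_hom_linearI)

lemma br_anti: "br y x = - br x y"
proof -
  have "br (x + y) (x + y) = br x x + br x y + br y x + br y y"
    by (simp add: br_left.add br_right.add)
  then have "br x y + br y x = 0" by (simp add: br_alternating)
  then show ?thesis by (simp add: eq_neg_iff_add_eq_0 add.commute)
qed

lemma br_br: "br (br x y) z = br x (br y z) - br y (br x z)"
proof -
  have "br z (br x y) + (br x (br y z) + br y (br z x)) = 0"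
    using jacobi[of x y z] by (simp add: add_ac)
  then show ?thesis
    using minus_unique br_anti[of "br x y" z] br_anti[of x z] by (force simp: br_right.neg)
qed

end

context quadratic_lie_algebra
begin

sublocale B_right: module_hom scale "(*)" "B x" for x
  using B_linear_right by (rule module_hom_linearI)

sublocale B_left: module_hom scale "(*)" "\<lambda>x. B x y" for y
  using B_linear_left by (rule module_hom_linearI)

end

section \<open>Dual bases of \<pp> and \<kk>\<close>

context graded_quadratic_lie_algebra
begin

lemma basis_finite: "is_basis_of scale X U \<Longrightarrow> finite X"
  using finite_dim independent_span_bound by (auto simp: is_basis_of_def)

lemma dual_space_sum:
  assumes "\<alpha> \<in> dual_space scale \<pp>" "\<And>i. i \<in> I \<Longrightarrow> f i \<in> \<pp>"
  shows "\<alpha> (\<Sum>i\<in>I. scale (c i) (f i)) = (\<Sum>i\<in>I. c i * \<alpha> (f i))"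
proof -
  \<comment> \<open>The value 0 at the origin is extracted from homogeneity with the scalar 0; it is
    needed for empty sums.\<close>
  have "scale 0 0 \<in> \<pp>" using subspace_p by (simp add: subspace_0)
  then have "\<alpha> (scale 0 0) = 0 * \<alpha> 0"
    using assms(1) subspace_p unfolding dual_space_def by (blast intro: subspace_0)
  then have 0: "\<alpha> 0 = 0" by simp
  show ?thesis using assms(2)
  proof (induction I rule: infinite_finite_induct)
    case (insert i I)
    then have "scale (c i) (f i) \<in> \<pp>" "(\<Sum>i\<in>I. scale (c i) (f i)) \<in> \<pp>"
      using subspace_p by (auto intro!: subspace_scale subspace_sum)
    with insert assms(1) show ?case by (simp add: dual_space_def)
  qed (simp_all add: 0)
qed

text \<open>The coordinate function extended by zero satisfies the description; a functional is
  fixed by its values on \<open>Z\<close> and by being zero off \<pp>, so the \<open>THE\<close>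
  denotes it.\<close>

lemma dual_basis_props:
  assumes Z: "is_basis_of scale Z \<pp>" and z: "z \<in> Z"
  shows "dual_basis scale \<pp> Z z \<in> dual_space scale \<pp>"
    and "x \<in> \<pp> \<Longrightarrow> dual_basis scale \<pp> Z z x = representation Z x z"
proof -
  have ind: "independent Z" and span: "span Z = \<pp>" and fin: "finite Z"
    using Z basis_finite by (auto simp: is_basis_of_def)
  define \<delta> where "\<delta> = (\<lambda>x. if x \<in> \<pp> then representation Z x z else 0)"
  have \<delta>: "\<delta> \<in> dual_space scale \<pp>" "\<forall>z'\<in>Z. \<delta> z' = (if z' = z then 1 else 0)"
    using ind span subspace_p
    by (auto simp: \<delta>_def dual_space_def representation_add representation_scale representation_basis
        subspace_add subspace_scale span_base)
  have "dual_basis scale \<pp> Z z = \<delta>" unfolding dual_basis_def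
  proof (rule the_equality)
    fix \<alpha> assume \<alpha>: "\<alpha> \<in> dual_space scale \<pp> \<and> (\<forall>z'\<in>Z. \<alpha> z' = (if z' = z then 1 else 0))"
    have "\<alpha> x = \<delta> x" for x
    proof (cases "x \<in> \<pp>")
      case True
      have Zp: "\<And>z. z \<in> Z \<Longrightarrow> z \<in> \<pp>" using span span_base by blast
      have x: "x = (\<Sum>b\<in>Z. scale (representation Z x b) b)"
        using sum_representation_eq[OF ind _ fin order_refl, of x] True span by simp
      have "\<alpha> x = (\<Sum>b\<in>Z. representation Z x b * \<alpha> b)"
        using dual_space_sum[of \<alpha> Z "\<lambda>b. b" "representation Z x"] Zp \<alpha> x by simp
      moreover have "\<delta> x = (\<Sum>b\<in>Z. representation Z x b * \<delta> b)"
        using dual_space_sum[of \<delta> Z "\<lambda>b. b" "representation Z x"] Zp \<delta> x by simp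
      ultimately show ?thesis using \<alpha> \<delta>(2) by simp
    next
      case False
      then show ?thesis using \<alpha> by (simp add: dual_space_def \<delta>_def)
    qed
    then show "\<alpha> = \<delta>" by blast
  qed (use \<delta> in blast)
  then show "dual_basis scale \<pp> Z z \<in> dual_space scale \<pp>"
    and "x \<in> \<pp> \<Longrightarrow> dual_basis scale \<pp> Z z x = representation Z x z"
    using \<delta> by (simp_all add: \<delta>_def)
qed

lemma dual_basis_expand:
  assumes Z: "is_basis_of scale Z \<pp>" and x: "x \<in> \<pp>"
  shows "(\<Sum>z\<in>Z. scale (dual_basis scale \<pp> Z z x) z) = x"
  using sum_representation_eq[of Z x Z] assms basis_finite[OF Z] dual_basis_props(2)[OF Z _ x]
  by (simp add: is_basis_of_def)

text \<open>Orthogonality to \<pp> lets \<open>B\<close> restricted to \<kk> inherit nondegeneracy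
  from the whole algebra.\<close>

lemma B_nondegenerate_k:
  assumes "x \<in> \<kk>" "\<And>y. y \<in> \<kk> \<Longrightarrow> B x y = 0"
  shows "x = 0"
proof (rule B_nondegenerate)
  fix g
  obtain y z where "y \<in> \<kk>" "z \<in> \<pp>" "g = y + z" using total by blast
  then show "B x g = 0" using assms orthogonal[of x z] by (simp add: B_right.add)
qed

lemma eq_if_B_basis_eq:
  assumes "is_basis_of scale X \<kk>" "y \<in> \<kk>" "y' \<in> \<kk>" and eq: "\<And>w. w \<in> X \<Longrightarrow> B w y = B w y'"
  shows "y = y'"
proof -
  have "B (y - y') v = 0" if "v \<in> span X" for v
    using that
    by (induction rule: span_induct_alt) (simp_all add: eq B_sym[of "y - y'"] B_left.add B_left.scale B_right.diff)
  then have "y - y' = 0"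
    using assms subspace_diff[OF subspace_k] by (intro B_nondegenerate_k) (auto simp: is_basis_of_def)
  then show ?thesis by simp
qed

text \<open>The map \<phi>, which assembles the values B(v,y) into a vector of \<kk>, is injective
  on \<kk> by nondegeneracy and so, by dimension, onto. The dual vector of w is its preimage of
  w.\<close>

lemma B_dual_basis_props:
  assumes X: "is_basis_of scale X \<kk>" and w: "w \<in> X"
  shows "B_dual_basis B \<kk> X w \<in> \<kk>"
    and "w' \<in> X \<Longrightarrow> B w' (B_dual_basis B \<kk> X w) = (if w' = w then 1 else 0)"
proof -
  have ind: "independent X" and span: "span X = \<kk>" and fin: "finite X"
    using X basis_finite by (auto simp: is_basis_of_def)
  define \<phi> where "\<phi> y = (\<Sum>v\<in>X. scale (B v y) v)" for y
  interpret \<phi>: module_hom scale scale \<phi>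
    by (simp add: module_hom_iff module_axioms \<phi>_def B_right.add B_right.scale scale_left_distrib
        sum.distrib scale_sum_right)
  have coeff: "B v y = c v" if "\<phi> y = (\<Sum>v\<in>X. scale (c v) v)" "v \<in> X" for y c v
  proof -
    have "(\<Sum>v\<in>X. scale (B v y - c v) v) = 0"
      using that(1) by (simp add: \<phi>_def scale_left_diff_distrib sum_subtractf)
    then show ?thesis using independentD[OF ind fin order_refl _ that(2)] by fastforce
  qed
  have inj: "inj_on \<phi> (span X)"
  proof (rule inj_onI)
    fix x y assume "x \<in> span X" "y \<in> span X" "\<phi> x = \<phi> y"
    then show "x = y"
      using coeff[of x "\<lambda>v. B v y"] by (intro eq_if_B_basis_eq[OF X]) (auto simp: span \<phi>_def)
  qed
  have ind': "independent (\<phi> ` X)" using ind inj by (rule \<phi>.independent_injective_image)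
  have card: "card (\<phi> ` X) = card X"
    using inj span_superset[of X] by (intro card_image) (rule inj_on_subset)
  have im: "\<phi> ` X \<subseteq> span X" unfolding \<phi>_def by (intro image_subsetI span_sum span_scale) (rule span_base)
  \<comment> \<open>Otherwise w together with the image of \<open>X\<close> would be
    \<open>card X + 1\<close> independent vectors in the span of \<open>X\<close>.\<close>
  have "w \<in> span (\<phi> ` X)"
  proof (rule ccontr)
    assume nw: "w \<notin> span (\<phi> ` X)"
    then have "independent (insert w (\<phi> ` X))" using ind' by (rule independent_insertI)
    moreover have "insert w (\<phi> ` X) \<subseteq> span X" using im w by (auto intro: span_base)
    ultimately have "card (insert w (\<phi> ` X)) \<le> card X"
      using independent_span_bound[OF fin] by blast
    moreover have "w \<notin> \<phi> ` X" using nw span_base by blast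
    ultimately show False using fin card by simp
  qed
  then obtain y where y: "y \<in> \<kk>" "\<phi> y = w" by (auto simp: \<phi>.span_image span)
  have "w = (\<Sum>v\<in>X. scale (if v = w then 1 else 0) v)"
    using fin w by (simp add: if_distrib[of "\<lambda>c. scale c _"] sum.delta cong: if_cong)
  then have yw: "B v y = (if v = w then 1 else 0)" if "v \<in> X" for v
    using coeff[of y "\<lambda>v. if v = w then 1 else 0"] y(2) that by simp
  have "B_dual_basis B \<kk> X w = y"
    unfolding B_dual_basis_def
  proof (rule the_equality)
    fix x assume "x \<in> \<kk> \<and> (\<forall>w'\<in>X. B w' x = (if w' = w then 1 else 0))"
    then show "x = y" using y(1) yw by (intro eq_if_B_basis_eq[OF X]) auto
  qed (use y yw in blast)
  then show "B_dual_basis B \<kk> X w \<in> \<kk>"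
    and "w' \<in> X \<Longrightarrow> B w' (B_dual_basis B \<kk> X w) = (if w' = w then 1 else 0)"
    using y yw by simp_all
qed

text \<open>Pairing y with the dual vector of w reads off the w-coordinate of y, so the sum expands
  the second argument of B(y,y). This collapses the Casimir sum to one value of
  \<open>B\<close>.\<close>

lemma sum_B_dual_basis:
  assumes X: "is_basis_of scale X \<kk>" and y: "y \<in> \<kk>"
  shows "(\<Sum>w\<in>X. B y w * B y (B_dual_basis B \<kk> X w)) = B y y"
proof -
  have ind: "independent X" and span: "span X = \<kk>" and fin: "finite X"
    using X basis_finite by (auto simp: is_basis_of_def)
  define c where "c = representation X y"
  have yc: "y = (\<Sum>v\<in>X. scale (c v) v)"
    using sum_representation_eq[OF ind _ fin order_refl, of y] y span by (simp add: c_def)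
  have "B y (B_dual_basis B \<kk> X w) = c w" if "w \<in> X" for w
  proof -
    have "B y (B_dual_basis B \<kk> X w) = (\<Sum>v\<in>X. c v * B v (B_dual_basis B \<kk> X w))"
      by (subst yc) (simp add: B_left.sum B_left.scale)
    also have "\<dots> = (\<Sum>v\<in>X. if v = w then c v else 0)"
      using B_dual_basis_props(2)[OF X that] by (intro sum.cong) auto
    finally show ?thesis using fin that by simp
  qed
  moreover have "B y y = (\<Sum>v\<in>X. c v * B y v)"
    by (subst (2) yc) (simp add: B_right.sum B_right.scale)
  ultimately show ?thesis by (simp add: mult.commute)
qed

end

text \<open>The form \<open>R(u,v,w,t) = B([u,v],[w,t])\<close> has the symmetries of a curvature tensor, hence is
  determined by its sectional values \<open>R(u,v,u,v)\<close>.\<close>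

lemma exists_sectional_nonzero:
  fixes scale :: "'k::field_char_0 \<Rightarrow> 'g::ab_group_add \<Rightarrow> 'g"
  assumes "graded_quadratic_lie_algebra scale br B \<kk> \<pp>"
    and "{B u v | u v. u \<in> bracket_space scale br \<pp> \<pp> \<and> v \<in> bracket_space scale br \<pp> \<pp>} \<noteq> {0}"
  obtains u v where "u \<in> \<pp>" "v \<in> \<pp>" "B (br u v) (br u v) \<noteq> 0"
proof -
  interpret graded_quadratic_lie_algebra scale br B \<kk> \<pp> by fact
  define R where "R u v w t = B (br u v) (br w t)" for u v w t
  have False if sec: "\<And>u v. u \<in> \<pp> \<Longrightarrow> v \<in> \<pp> \<Longrightarrow> R u v u v = 0"
  proof -
    have p: "u + v \<in> \<pp>" if "u \<in> \<pp>" "v \<in> \<pp>" for u v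
      using subspace_p that by (rule subspace_add)
    have a12: "R v u w t = - R u v w t" for u v w t
      by (simp add: R_def br_anti[of v u] B_left.neg)
    have pair: "R w t u v = R u v w t" for u v w t by (simp add: R_def B_sym)
    have lin1: "R (u + u') v w t = R u v w t + R u' v w t" for u u' v w t
      by (simp add: R_def br_left.add B_left.add)
    have lin2: "R u (v + v') w t = R u v w t + R u v' w t" for u v v' w t
      by (simp add: R_def br_right.add B_left.add)
    have lin3: "R u v (w + w') t = R u v w t + R u v w' t" for u v w w' t
      by (simp add: R_def br_left.add B_right.add)
    have lin4: "R u v w (t + t') = R u v w t + R u v w t'" for u v w t t'
      by (simp add: R_def br_right.add B_right.add)
    \<comment> \<open>The Jacobi identity for u, v, w paired with t, using B([[u,v],w],t) =
      B([u,v],[w,t]).\<close>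
    have bianchi: "R u v w t + R v w u t + R w u v t = 0" for u v w t
    proof -
      have "br (br u v) w + br (br v w) u + br (br w u) v = 0"
        unfolding br_anti[of "br u v" w] br_anti[of "br v w" u] br_anti[of "br w u" v]
        by (simp only: jacobi[of w u v] neg_equal_0_iff_equal flip: minus_add_distrib)
      then have "B (br (br u v) w + br (br v w) u + br (br w u) v) t = 0" by (simp add: B_left.zero)
      then show ?thesis by (simp add: R_def B_left.add B_invariant)
    qed
    \<comment> \<open>Polarizing \<open>sec\<close> in u gives 2 R(u,v,w,v) = 0 by the pair
      symmetry, and 2 is invertible.\<close>
    have q: "R u v w v = 0" if "u \<in> \<pp>" "v \<in> \<pp>" "w \<in> \<pp>" for u v w
      using sec[OF p[OF that(1,3)] that(2)] sec[OF that(1,2)] sec[OF that(3,2)] pair[of w v u v]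
      by (simp add: lin1 lin3)
    \<comment> \<open>A second polarization, in v, makes R antisymmetric in its second and fourth
      arguments.\<close>
    have a24: "R u v w t = - R u t w v" if "u \<in> \<pp>" "v \<in> \<pp>" "w \<in> \<pp>" "t \<in> \<pp>" for u v w t
      using q[OF that(1) p[OF that(2,4)] that(3)] q[OF that(1-3)] q[OF that(1,4,3)]
      by (simp add: lin2 lin4 eq_neg_iff_add_eq_0 add.commute)
    have cyc: "R v w u t = R u v w t" if "u \<in> \<pp>" "v \<in> \<pp>" "w \<in> \<pp>" "t \<in> \<pp>" for u v w t
      using a12[of w v u t] a24[of w v u t] pair[of w t u v] that by simp
    \<comment> \<open>By \<open>cyc\<close> the three terms of the Bianchi identity are equal, so 3
      R = 0 in characteristic 0.\<close>
    have zero: "R u v w t = 0" if "u \<in> \<pp>" "v \<in> \<pp>" "w \<in> \<pp>" "t \<in> \<pp>" for u v w t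
      using bianchi[of u v w t] cyc[OF that] cyc[OF that(2,3,1,4)] by simp
    have "B a b = 0" if a: "a \<in> bracket_space scale br \<pp> \<pp>" and b: "b \<in> bracket_space scale br \<pp> \<pp>" for a b
      using a unfolding bracket_space_def
    proof (induction rule: span_induct_alt)
      case (step c x y)
      have "B x b = 0"
        using b unfolding bracket_space_def
        by (induction rule: span_induct_alt)
           (use step(1) zero in \<open>auto simp: R_def B_right.zero B_right.add B_right.scale\<close>)
      with step show ?case by (simp add: B_left.add B_left.scale)
    qed (simp add: B_left.zero)
    moreover have "0 \<in> bracket_space scale br \<pp> \<pp>" by (simp add: bracket_space_def span_zero)
    moreover have "B 0 0 = 0" by (rule B_right.zero)
    ultimately have "{B u v | u v. u \<in> bracket_space scale br \<pp> \<pp> \<and> v \<in> bracket_space scale br \<pp> \<pp>} = {0}"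
      by fastforce
    with assms(2) show False by contradiction
  qed
  then show ?thesis using that by (auto simp: R_def)
qed


section \<open>The morphism \<open>\<nu>\<close>\<close>

lemma scal_sum: "scal (sum f I) = (\<Sum>i\<in>I. scal (f i))"
  by (induction I rule: infinite_finite_induct) (simp_all add: single_add)

lemma lext_mult:
  assumes h: "\<And>us ws. h (us @ ws) = h us * h ws"
  shows "lext h (f * g) = lext h f * lext h g"
proof -
  have 1: "lext h (wd us * g) = h us * lext h g" for us
  proof (induction rule: free_induct[OF in_free_UNIV[of g]])
    case (2 c ws g)
    have "wd us * (scal c * wd ws + g) = scal c * wd (us @ ws) + wd us * g"
      by (simp add: distrib_left wd_append scal_left_commute)
    then show ?case using 2(3) by (simp add: lext_add lext_scal h distrib_left scal_left_commute)
  qed simp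
  show ?thesis
  proof (induction rule: free_induct[OF in_free_UNIV[of f]])
    case (2 c us f)
    then show ?case by (simp add: distrib_right mult.assoc lext_add lext_scal 1)
  qed simp
qed

lemma (in presentation) alg_hom_eqI:
  assumes "\<phi> \<in> alg_hom A C" "\<psi> \<in> alg_hom A C"
    and gen: "\<And>v. v \<in> V \<Longrightarrow> \<phi> (q (wd [v])) = \<psi> (q (wd [v]))"
    and "f \<in> free_carrier V"
  shows "\<phi> (q f) = \<psi> (q f)"
proof (rule linear_maps_eqI[OF _ _ _ assms(4)])
  show "\<phi> \<in> linear_maps A C" "\<psi> \<in> linear_maps A C" using assms(1,2) by (simp_all add: alg_hom_def)
  have hom: "\<phi> \<in> ring_hom A C" "\<psi> \<in> ring_hom A C" using assms(1,2) by (simp_all add: alg_hom_def)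
  show "\<phi> (q (wd us)) = \<psi> (q (wd us))" if "set us \<subseteq> V" for us
    using that
  proof (induction us)
    case Nil
    then show ?case by (simp add: wd_Nil q_one ring_hom_one[OF hom(1)] ring_hom_one[OF hom(2)])
  next
    case (Cons v us)
    then have "q (wd (v # us)) = q (wd [v]) \<otimes>\<^bsub>A\<^esub> q (wd us)"
      by (subst wd_Cons) (simp add: q_mult)
    with Cons gen show ?case by (simp add: ring_hom_mult[OF hom(1)] ring_hom_mult[OF hom(2)])
  qed
qed

section \<open>Lifting \<nu> to the free algebra\<close>

context graded_quadratic_lie_algebra
begin

lemma zero_in_dual_space: "0 \<in> dual_space scale \<pp>"
  by (simp add: dual_space_def)

lemma dual_space_add: "\<alpha> \<in> dual_space scale \<pp> \<Longrightarrow> \<beta> \<in> dual_space scale \<pp> \<Longrightarrow> \<alpha> + \<beta> \<in> dual_space scale \<pp>"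
  by (simp add: dual_space_def distrib_left)

lemma dual_space_scale: "\<alpha> \<in> dual_space scale \<pp> \<Longrightarrow> (\<lambda>x. c * \<alpha> x) \<in> dual_space scale \<pp>"
  by (simp add: dual_space_def distrib_left mult.left_commute)

lemma linear_closed_symp_space: "linear_closed (symp_scale scale) (symp_space scale \<pp>)"
proof (rule linear_closed.intro)
  fix v w :: "'g \<times> ('g \<Rightarrow> 'k)" and c
  assume v: "v \<in> symp_space scale \<pp>"
  then show "symp_scale scale c v \<in> symp_space scale \<pp>"
    by (auto simp: symp_space_def symp_scale_def subspace_scale[OF subspace_p] dual_space_scale)
  assume "w \<in> symp_space scale \<pp>"
  with v show "v + w \<in> symp_space scale \<pp>"
    by (auto simp: symp_space_def subspace_add[OF subspace_p] dual_space_add)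
qed

lemma linear_closed_k: "linear_closed scale \<kk>"
  by unfold_locales (use subspace_k in \<open>auto simp: subspace_add subspace_scale\<close>)

abbreviation vec :: "'g \<Rightarrow> 'g \<times> ('g \<Rightarrow> 'k)" where
  "vec v \<equiv> (v, 0)"

abbreviation weyl_rel_ideal :: "(('g \<times> ('g \<Rightarrow> 'k)) word \<Rightarrow>\<^sub>0 'k) set" where
  "weyl_rel_ideal \<equiv> tideal (symp_space scale \<pp>)
     (lin_rel (symp_scale scale) (symp_space scale \<pp>) \<union> com_rel (symp_space scale \<pp>) symp_form)"

definition nu_word :: "'g set \<Rightarrow> 'g \<Rightarrow> (('g \<times> ('g \<Rightarrow> 'k)) word \<Rightarrow>\<^sub>0 'k)" where
  "nu_word Z x = (\<Sum>z\<in>Z. wd [vec (br x z), (0, dual_basis scale \<pp> Z z)])"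

definition nu_ext :: "'g set \<Rightarrow> ('g word \<Rightarrow>\<^sub>0 'k) \<Rightarrow> (('g \<times> ('g \<Rightarrow> 'k)) word \<Rightarrow>\<^sub>0 'k)" where
  "nu_ext Z = lext (\<lambda>us. prod_list (map (nu_word Z) us))"

lemma vector_in_symp: "v \<in> \<pp> \<Longrightarrow> vec v \<in> symp_space scale \<pp>"
  by (simp add: symp_space_def zero_in_dual_space)

lemma covector_in_symp: "\<alpha> \<in> dual_space scale \<pp> \<Longrightarrow> (0, \<alpha>) \<in> symp_space scale \<pp>"
  by (simp add: symp_space_def subspace_0[OF subspace_p])

lemma vector_add_rel:
  assumes "v \<in> \<pp>" "w \<in> \<pp>"
  shows "wd [vec (v + w)] - (wd [vec v] + wd [vec w]) \<in> weyl_rel_ideal"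
proof -
  have "wd [vec v + vec w] - (wd [vec v] + wd [vec w]) \<in>
      lin_rel (symp_scale scale) (symp_space scale \<pp>)"
    unfolding lin_rel_def using assms vector_in_symp by blast
  then show ?thesis by (auto intro: tideal_incl)
qed

lemma vector_scale_rel:
  assumes "v \<in> \<pp>"
  shows "wd [vec (scale c v)] - scal c * wd [vec v] \<in> weyl_rel_ideal"
proof -
  have "wd [symp_scale scale c (vec v)] - scal c * wd [vec v] \<in>
      lin_rel (symp_scale scale) (symp_space scale \<pp>)"
    unfolding lin_rel_def using assms vector_in_symp by blast
  moreover have "symp_scale scale c (vec v) = vec (scale c v)" by (auto simp: symp_scale_def)
  ultimately show ?thesis by (auto intro: tideal_incl)
qed

text \<open>Serves to reassemble a bracket from its coordinates in the basis
  \<open>Z\<close>.\<close>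

lemma vector_sum_rel:
  assumes "\<And>i. i \<in> I \<Longrightarrow> v i \<in> \<pp>"
  shows "wd [vec (\<Sum>i\<in>I. scale (c i) (v i))] - (\<Sum>i\<in>I. scal (c i) * wd [vec (v i)]) \<in> weyl_rel_ideal"
  using assms
proof (induction I rule: infinite_finite_induct)
  case (insert i I)
  let ?S = "\<Sum>i\<in>I. scale (c i) (v i)"
  have p: "scale (c i) (v i) \<in> \<pp>" "?S \<in> \<pp>"
    using insert.prems subspace_p by (auto intro!: subspace_scale subspace_sum)
  have "(wd [vec (scale (c i) (v i) + ?S)] - (wd [vec (scale (c i) (v i))] + wd [vec ?S])) +
      (wd [vec (scale (c i) (v i))] - scal (c i) * wd [vec (v i)]) +
      (wd [vec ?S] - (\<Sum>i\<in>I. scal (c i) * wd [vec (v i)])) \<in> weyl_rel_ideal"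
    using insert.prems p by (intro tideal_add vector_add_rel vector_scale_rel insert.IH) simp_all
  with insert.hyps show ?case by (simp add: algebra_simps del: zero_fun_apply)
qed (use vector_scale_rel[of 0 0] subspace_0[OF subspace_p] in auto)

lemma commutator_rel:
  assumes "p \<in> symp_space scale \<pp>" "q \<in> symp_space scale \<pp>"
  shows "wd [p] * wd [q] - wd [q] * wd [p] - scal (symp_form p q) \<in> weyl_rel_ideal"
proof -
  have "wd [p, q] - wd [q, p] - scal (symp_form p q) \<in> com_rel (symp_space scale \<pp>) symp_form"
    unfolding com_rel_def using assms by blast
  then show ?thesis by (auto intro: tideal_incl simp: wd_Cons[of _ "[_]"])
qed

lemma dual_space_zero: "\<alpha> \<in> dual_space scale \<pp> \<Longrightarrow> \<alpha> 0 = 0"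
  using dual_space_sum[of \<alpha> "{}"] by simp

lemma nu_word_in_free:
  assumes Z: "is_basis_of scale Z \<pp>" and x: "x \<in> \<kk>"
  shows "nu_word Z x \<in> free_carrier (symp_space scale \<pp>)"
  unfolding nu_word_def
proof (intro sum_in_free wd_in_free)
  fix z assume z: "z \<in> Z"
  then have "z \<in> \<pp>" using Z span_base by (auto simp: is_basis_of_def)
  then show "set [vec (br x z), (0, dual_basis scale \<pp> Z z)] \<subseteq> symp_space scale \<pp>"
    using vector_in_symp covector_in_symp dual_basis_props(1)[OF Z z] br_kp x by simp
qed

text \<open>Writes the commutator of a b and a' b' through the four commutators of single letters,
  exactly in the free algebra. The constants c and c' stand for the two pairings of a covector with
  a vector; \<open>scal 0\<close> is kept so that all four brackets have the shape of
  \<open>commutator_rel\<close>.\<close>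

lemma commutator_identity:
  fixes a b a' b' :: "'w word \<Rightarrow>\<^sub>0 'f::field"
  shows "a * b * (a' * b') - a' * b' * (a * b) - scal c * (a * b') + scal c' * (a' * b) =
    a * (b * a' - a' * b - scal c) * b' + (a * a' - a' * a - scal 0) * (b * b')
    - a' * (b' * a - a * b' - scal c') * b + a' * a * (b * b' - b' * b - scal 0)"
  by (simp add: algebra_simps scal_left_commute flip: scal_commute)

text \<open>The commutator of the two sums leaves the contractions [x,[y,z]] and [y,[x,z]] in front
  of the dual covector of z, and by the Jacobi identity their difference is [[x,y],z]. The errors
  are collected by type: \<open>C\<close> for commutators, \<open>D\<close> for expanding in the
  basis, \<open>E\<close> for Jacobi and additivity.\<close>

lemma nu_word_bracket:
  assumes Z: "is_basis_of scale Z \<pp>" and x: "x \<in> \<kk>" and y: "y \<in> \<kk>"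
  shows "nu_word Z x * nu_word Z y - nu_word Z y * nu_word Z x - nu_word Z (br x y) \<in> weyl_rel_ideal"
proof -
  let ?V = "symp_space scale \<pp>" and ?d = "dual_basis scale \<pp> Z"
  define a :: "'g \<Rightarrow> ('g \<times> ('g \<Rightarrow> 'k)) word \<Rightarrow>\<^sub>0 'k" where "a v = wd [vec v]" for v
  define b :: "'g \<Rightarrow> ('g \<times> ('g \<Rightarrow> 'k)) word \<Rightarrow>\<^sub>0 'k" where "b z = wd [(0, ?d z)]" for z
  have Zp: "z \<in> \<pp>" if "z \<in> Z" for z using Z that span_base by (auto simp: is_basis_of_def)
  have d: "?d z \<in> dual_space scale \<pp>" if "z \<in> Z" for z using dual_basis_props(1)[OF Z that] .
  have N: "nu_word Z u = (\<Sum>z\<in>Z. a (br u z) * b z)" for u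
    unfolding nu_word_def a_def b_def by (intro sum.cong refl) (rule wd_Cons)
  have aV: "a v \<in> free_carrier ?V" if "v \<in> \<pp>" for v
    unfolding a_def using that vector_in_symp by simp
  have bV: "b z \<in> free_carrier ?V" if "z \<in> Z" for z
    unfolding b_def using d[OF that] covector_in_symp by simp
  define C where "C z z' = a (br x z) * b z * (a (br y z') * b z') - a (br y z') * b z' * (a (br x z) * b z)
      - scal (?d z (br y z')) * (a (br x z) * b z') + scal (?d z' (br x z)) * (a (br y z') * b z)" for z z'
  have C: "C z z' \<in> weyl_rel_ideal" if z: "z \<in> Z" "z' \<in> Z" for z z'
  proof -
    have p: "br x z \<in> \<pp>" "br y z' \<in> \<pp>" using br_kp x y Zp z by auto
    have c1: "b z * a (br y z') - a (br y z') * b z - scal (?d z (br y z')) \<in> weyl_rel_ideal"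
      using commutator_rel[OF covector_in_symp[OF d[OF z(1)]] vector_in_symp[OF p(2)]]
      by (simp add: symp_form_def a_def b_def)
    have c2: "b z' * a (br x z) - a (br x z) * b z' - scal (?d z' (br x z)) \<in> weyl_rel_ideal"
      using commutator_rel[OF covector_in_symp[OF d[OF z(2)]] vector_in_symp[OF p(1)]]
      by (simp add: symp_form_def a_def b_def)
    have c3: "a (br x z) * a (br y z') - a (br y z') * a (br x z) - scal 0 \<in> weyl_rel_ideal"
      using commutator_rel[OF vector_in_symp[OF p(1)] vector_in_symp[OF p(2)]]
      by (simp add: symp_form_def a_def)
    have c4: "b z * b z' - b z' * b z - scal 0 \<in> weyl_rel_ideal"
      using commutator_rel[OF covector_in_symp[OF d[OF z(1)]] covector_in_symp[OF d[OF z(2)]]]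
      by (simp add: symp_form_def b_def dual_space_zero d z)
    note t1 = tideal_right[OF bV[OF z(2)] tideal_left[OF aV[OF p(1)] c1]]
      and t2 = tideal_right[OF mult_in_free[OF bV[OF z(1)] bV[OF z(2)]] c3]
      and t3 = tideal_right[OF bV[OF z(1)] tideal_left[OF aV[OF p(2)] c2]]
      and t4 = tideal_left[OF mult_in_free[OF aV[OF p(2)] aV[OF p(1)]] c4]
    show ?thesis
      unfolding C_def commutator_identity by (rule tideal_add[OF tideal_diff[OF tideal_add[OF t1 t2] t3] t4])
  qed
  define D where "D u v z = a (br u (br v z)) - (\<Sum>z'\<in>Z. scal (?d z' (br v z)) * a (br u z'))" for u v z
  have D: "D u v z \<in> weyl_rel_ideal" if "u \<in> \<kk>" "v \<in> \<kk>" "z \<in> Z" for u v z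
  proof -
    have "br v z \<in> \<pp>" using br_kp that Zp by auto
    then have "br u (br v z) = (\<Sum>z'\<in>Z. scale (?d z' (br v z)) (br u z'))"
      by (simp add: dual_basis_expand[OF Z] flip: br_right.scale br_right.sum)
    then show ?thesis
      unfolding D_def a_def using vector_sum_rel[of Z "br u" "\<lambda>z'. ?d z' (br v z)"] br_kp that(1) Zp by simp
  qed
  define E where "E z = a (br x (br y z)) - (a (br (br x y) z) + a (br y (br x z)))" for z
  have E: "E z \<in> weyl_rel_ideal" if z: "z \<in> Z" for z
  proof -
    have "br x (br y z) = br (br x y) z + br y (br x z)" by (simp add: br_br)
    then show ?thesis
      unfolding E_def a_def using vector_add_rel[of "br (br x y) z" "br y (br x z)"] br_kp br_kk x y Zp z by simp
  qed
  have 1: "(\<Sum>z\<in>Z. \<Sum>z'\<in>Z. C z z') = nu_word Z x * nu_word Z y - nu_word Z y * nu_word Z x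
      - (\<Sum>z'\<in>Z. (\<Sum>z\<in>Z. scal (?d z (br y z')) * a (br x z)) * b z')
      + (\<Sum>z\<in>Z. (\<Sum>z'\<in>Z. scal (?d z' (br x z)) * a (br y z')) * b z)"
  proof -
    have "(\<Sum>z\<in>Z. \<Sum>z'\<in>Z. a (br y z') * b z' * (a (br x z) * b z)) = nu_word Z y * nu_word Z x"
      unfolding N sum_product by (rule sum.swap)
    moreover have "(\<Sum>z\<in>Z. \<Sum>z'\<in>Z. scal (?d z (br y z')) * (a (br x z) * b z')) =
        (\<Sum>z'\<in>Z. (\<Sum>z\<in>Z. scal (?d z (br y z')) * a (br x z)) * b z')"
      unfolding sum_distrib_right mult.assoc by (rule sum.swap)
    moreover have "(\<Sum>z\<in>Z. \<Sum>z'\<in>Z. a (br x z) * b z * (a (br y z') * b z')) = nu_word Z x * nu_word Z y"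
      unfolding N sum_product by (rule refl)
    moreover have "(\<Sum>z\<in>Z. \<Sum>z'\<in>Z. scal (?d z' (br x z)) * (a (br y z') * b z)) =
        (\<Sum>z\<in>Z. (\<Sum>z'\<in>Z. scal (?d z' (br x z)) * a (br y z')) * b z)"
      unfolding sum_distrib_right mult.assoc by (rule refl)
    ultimately show ?thesis
      unfolding C_def sum.distrib sum_subtractf by (simp only:)
  qed
  have 2: "(\<Sum>z\<in>Z. (E z - D x y z + D y x z) * b z) =
      (\<Sum>z'\<in>Z. (\<Sum>z\<in>Z. scal (?d z (br y z')) * a (br x z)) * b z')
      - (\<Sum>z\<in>Z. (\<Sum>z'\<in>Z. scal (?d z' (br x z)) * a (br y z')) * b z) - nu_word Z (br x y)"
    by (simp add: E_def D_def N left_diff_distrib distrib_right sum.distrib sum_subtractf)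
  \<comment> \<open>The contraction sums in \<open>1\<close> and \<open>2\<close> have opposite
    signs and cancel, leaving exactly the claimed expression.\<close>
  have "(\<Sum>z\<in>Z. \<Sum>z'\<in>Z. C z z') + (\<Sum>z\<in>Z. (E z - D x y z + D y x z) * b z) \<in> weyl_rel_ideal"
    using C D E x y bV by (intro tideal_add tideal_sum tideal_right tideal_diff) auto
  then show ?thesis unfolding 1 2 by simp
qed

lemma nu_word_linear:
  assumes Z: "is_basis_of scale Z \<pp>" and x: "x \<in> \<kk>" and y: "y \<in> \<kk>"
  shows "nu_word Z (x + y) - (nu_word Z x + nu_word Z y) \<in> weyl_rel_ideal"
    and "nu_word Z (scale c x) - scal c * nu_word Z x \<in> weyl_rel_ideal"
proof -
  have Zp: "z \<in> \<pp>" if "z \<in> Z" for z using Z that span_base by (auto simp: is_basis_of_def)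
  have bV: "wd [(0, dual_basis scale \<pp> Z z)] \<in> free_carrier (symp_space scale \<pp>)" if "z \<in> Z" for z
    using covector_in_symp[OF dual_basis_props(1)[OF Z that]] by simp
  have "(\<Sum>z\<in>Z. (wd [vec (br x z + br y z)] - (wd [vec (br x z)] + wd [vec (br y z)])) *
      wd [(0, dual_basis scale \<pp> Z z)]) \<in> weyl_rel_ideal"
    using x y by (intro tideal_sum tideal_right bV vector_add_rel br_kp Zp)
  then show "nu_word Z (x + y) - (nu_word Z x + nu_word Z y) \<in> weyl_rel_ideal"
    by (simp add: nu_word_def br_left.add wd_Cons[of _ "[_]"] left_diff_distrib distrib_right sum.distrib sum_subtractf)
  have "(\<Sum>z\<in>Z. (wd [vec (scale c (br x z))] - scal c * wd [vec (br x z)]) *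
      wd [(0, dual_basis scale \<pp> Z z)]) \<in> weyl_rel_ideal"
    using x by (intro tideal_sum tideal_right bV vector_scale_rel br_kp Zp)
  then show "nu_word Z (scale c x) - scal c * nu_word Z x \<in> weyl_rel_ideal"
    by (simp add: nu_word_def br_left.scale wd_Cons[of _ "[_]"] left_diff_distrib sum_subtractf sum_distrib_left mult.assoc)
qed

lemma nu_ext_mult: "nu_ext Z (f * g) = nu_ext Z f * nu_ext Z g"
  unfolding nu_ext_def by (rule lext_mult) simp

lemma nu_ext_in_free:
  assumes "is_basis_of scale Z \<pp>" "f \<in> free_carrier \<kk>"
  shows "nu_ext Z f \<in> free_carrier (symp_space scale \<pp>)"
  unfolding nu_ext_def
  by (rule lext_in_free[OF assms(2)]) (use nu_word_in_free[OF assms(1)] in \<open>auto simp: subset_iff intro!: prod_list_in_free\<close>)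

text \<open>Since \<open>nu_ext\<close> is multiplicative, only the bare relations have to be
  checked.\<close>

lemma nu_ext_ideal:
  assumes Z: "is_basis_of scale Z \<pp>" and f: "f \<in> tideal \<kk> (lin_rel scale \<kk> \<union> lie_rel \<kk> br)"
  shows "nu_ext Z f \<in> weyl_rel_ideal"
proof -
  have rel: "nu_ext Z r \<in> weyl_rel_ideal" if "r \<in> lin_rel scale \<kk> \<union> lie_rel \<kk> br" for r
    using that nu_word_linear[OF Z] nu_word_bracket[OF Z]
    by (auto simp: lin_rel_def lie_rel_def nu_ext_def lext_diff lext_add lext_scal)
  show ?thesis
    unfolding nu_ext_def
  proof (rule lext_tideal[OF f], fold nu_ext_def)
    fix us ws :: "'g list" and r
    assume "set us \<subseteq> \<kk>" "set ws \<subseteq> \<kk>" "r \<in> lin_rel scale \<kk> \<union> lie_rel \<kk> br"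
    then show "nu_ext Z (wd us * r * wd ws) \<in> weyl_rel_ideal"
      unfolding nu_ext_mult by (intro tideal_left tideal_right rel nu_ext_in_free[OF Z] wd_in_free)
  qed
qed

text \<open>The morphism induced by \<open>nu_ext\<close> witnesses the \<open>SOME\<close> in
  \<open>nu\<close>; algebra morphisms agreeing on generators agree, so \<open>nu\<close> is
  computed on representatives by \<open>nu_ext\<close>.\<close>

lemma nu_quot_cls:
  assumes Z: "is_basis_of scale Z \<pp>" and f: "f \<in> free_carrier \<kk>"
  shows "nu scale br \<kk> \<pp> Z (quot_cls scale \<kk> (env_ideal scale br \<kk>) f) =
    quot_cls (symp_scale scale) (symp_space scale \<pp>)
      (weyl_ideal (symp_scale scale) (symp_space scale \<pp>) symp_form) (nu_ext Z f)"
proof -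
  interpret k: linear_closed scale \<kk> by (rule linear_closed_k)
  interpret s: linear_closed "symp_scale scale" "symp_space scale \<pp>" by (rule linear_closed_symp_space)
  let ?U = "env_alg scale br \<kk>" and ?W = "weyl_p scale \<pp>"
  let ?qU = "quot_cls scale \<kk> (env_ideal scale br \<kk>)"
  let ?qW = "quot_cls (symp_scale scale) (symp_space scale \<pp>)
      (weyl_ideal (symp_scale scale) (symp_space scale \<pp>) symp_form)"
  note presU = k.presentation_env[where br = br, OF br_kk] and presW = s.presentation_weyl[of symp_form]
  interpret U: presentation \<kk> "tideal \<kk> (lin_rel scale \<kk> \<union> lie_rel \<kk> br)" ?U ?qU by (rule presU)
  interpret W: presentation "symp_space scale \<pp>" weyl_rel_ideal ?W ?qW by (rule presW)
  interpret WR: ring ?W by (rule W.ring_A)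
  have gen: "?qW (nu_word Z x) = nu_lie scale br \<pp> Z x" if x: "x \<in> \<kk>" for x
  proof -
    have V: "vec (br x z) \<in> symp_space scale \<pp>" "(0, dual_basis scale \<pp> Z z) \<in> symp_space scale \<pp>"
      if "z \<in> Z" for z
      using that Z x br_kp span_base
      by (auto simp: is_basis_of_def intro!: vector_in_symp covector_in_symp dual_basis_props(1)[OF Z])
    have "?qW (nu_word Z x) = (\<Oplus>\<^bsub>?W\<^esub>z\<in>Z. ?qW (wd [vec (br x z), (0, dual_basis scale \<pp> Z z)]))"
      unfolding nu_word_def using V basis_finite[OF Z] by (intro W.q_sum) auto
    also have "\<dots> = nu_lie scale br \<pp> Z x"
      unfolding nu_lie_def Let_def s.weyl_gen_eq
      using V by (intro WR.finsum_cong' refl) (auto simp: wd_Cons[of _ "[_]"] W.q_mult)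
    finally show ?thesis .
  qed
  obtain \<phi> where \<phi>: "\<phi> \<in> linear_maps ?U ?W" "\<And>f. f \<in> free_carrier \<kk> \<Longrightarrow> \<phi> (?qU f) = ?qW (nu_ext Z f)"
    by (rule presentation_induced[OF presU presW, where T = "nu_ext Z"])
      (use nu_ext_in_free[OF Z] nu_ext_ideal[OF Z] in \<open>auto simp: nu_ext_def lext_add lext_scal\<close>)
  have hom: "\<phi> \<in> alg_hom ?U ?W"
    using presU presW nu_ext_in_free[OF Z] nu_ext_mult _ \<phi>
    by (rule presentation_induced_alg_hom) (simp_all add: nu_ext_def flip: wd_Nil)
  define P where "P \<psi> \<longleftrightarrow> \<psi> \<in> alg_hom ?U ?W \<and>
     (\<forall>x\<in>\<kk>. \<psi> (env_gen scale br \<kk> x) = nu_lie scale br \<pp> Z x)" for \<psi>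
  have \<phi>_gen: "\<phi> (?qU (wd [x])) = nu_lie scale br \<pp> Z x" if "x \<in> \<kk>" for x
    using \<phi>(2)[of "wd [x]"] that gen by (simp add: nu_ext_def)
  then have "P \<phi>" using hom by (simp add: P_def k.env_gen_eq)
  moreover have "nu scale br \<kk> \<pp> Z = (SOME \<psi>. P \<psi>)"
    unfolding nu_def P_def by (rule refl)
  ultimately have "P (nu scale br \<kk> \<pp> Z)" by (simp only: someI[of P])
  then have nu: "nu scale br \<kk> \<pp> Z \<in> alg_hom ?U ?W"
    "\<And>x. x \<in> \<kk> \<Longrightarrow> nu scale br \<kk> \<pp> Z (?qU (wd [x])) = nu_lie scale br \<pp> Z x"
    unfolding P_def k.env_gen_eq by blast+
  have "nu scale br \<kk> \<pp> Z (?qU f) = \<phi> (?qU f)"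
    using nu(1) hom _ f by (rule U.alg_hom_eqI) (simp add: nu(2) \<phi>_gen)
  then show ?thesis using \<phi>(2)[OF f] by simp
qed

section \<open>The Casimir element and its leading term\<close>

lemma casimir_eq:
  assumes X: "is_basis_of scale X \<kk>"
  shows "casimir scale br B \<kk> X =
    quot_cls scale \<kk> (env_ideal scale br \<kk>) (\<Sum>w\<in>X. wd [w, B_dual_basis B \<kk> X w])"
proof -
  interpret k: linear_closed scale \<kk> by (rule linear_closed_k)
  let ?U = "env_alg scale br \<kk>" and ?qU = "quot_cls scale \<kk> (env_ideal scale br \<kk>)"
  interpret U: presentation \<kk> "tideal \<kk> (lin_rel scale \<kk> \<union> lie_rel \<kk> br)" ?U ?qU
    by (rule k.presentation_env[where br = br, OF br_kk])
  interpret UR: ring ?U by (rule U.ring_A)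
  have V: "w \<in> \<kk>" "B_dual_basis B \<kk> X w \<in> \<kk>" if "w \<in> X" for w
    using X that span_base B_dual_basis_props(1)[OF X that] by (auto simp: is_basis_of_def)
  have "?qU (\<Sum>w\<in>X. wd [w, B_dual_basis B \<kk> X w]) = (\<Oplus>\<^bsub>?U\<^esub>w\<in>X. ?qU (wd [w, B_dual_basis B \<kk> X w]))"
    using V basis_finite[OF X] by (intro U.q_sum) auto
  also have "\<dots> = casimir scale br B \<kk> X"
    unfolding casimir_def Let_def k.env_gen_eq
    using V by (intro UR.finsum_cong' refl) (auto simp: wd_Cons[of _ "[_]"] U.q_mult)
  finally show ?thesis by simp
qed

text \<open>\<open>-B([u,v],x)\<close> is the value at the point \<open>(B(u,\<cdot>), v)\<close> of the quadratic function underlying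
  \<open>\<nu>(x)\<close>, so the leading term of the Casimir element takes the value \<open>B([u,v],[u,v])\<close> there.\<close>

lemma wick_ext_nu_casimir:
  assumes X: "is_basis_of scale X \<kk>" and Z: "is_basis_of scale Z \<pp>" and u: "u \<in> \<pp>" and v: "v \<in> \<pp>"
  shows "wick_ext symp_form (\<lambda>(p, \<alpha>). B u p + \<alpha> v) 4 (nu_ext Z (\<Sum>w\<in>X. wd [w, B_dual_basis B \<kk> X w])) =
    scal (B (br u v) (br u v))"
proof -
  let ?d = "dual_basis scale \<pp> Z"
  define \<xi> :: "'g \<times> ('g \<Rightarrow> 'k) \<Rightarrow> 'k" where "\<xi> = (\<lambda>(p, \<alpha>). B u p + \<alpha> v)"
  \<comment> \<open>Expanding v in the basis \<open>Z\<close> turns the sum into B(u,[x,v]), and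
    invariance moves the bracket onto u. The sign disappears later in the product of two such
    factors.\<close>
  have ev: "(\<Sum>z\<in>Z. \<xi> (vec (br x z)) * \<xi> (0, ?d z)) = - B (br u v) x" for x
  proof -
    have "(\<Sum>z\<in>Z. \<xi> (vec (br x z)) * \<xi> (0, ?d z)) = B u (br x (\<Sum>z\<in>Z. scale (?d z v) z))"
      by (simp add: \<xi>_def B_right.zero br_right.sum br_right.scale B_right.sum B_right.scale mult.commute)
    also have "\<dots> = B u (br x v)" by (simp add: dual_basis_expand[OF Z v])
    finally show ?thesis by (simp add: br_anti[of x v] B_right.neg B_invariant)
  qed
  have W: "wick_ext symp_form \<xi> 4 (nu_word Z x * nu_word Z y) = scal (B (br u v) x * B (br u v) y)" for x y
  proof -
    \<comment> \<open>The words of a product of two \<open>nu_word\<close>s have exactly four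
      letters, so in degree 4 no pairing is possible.\<close>
    have "length [a, b, c, d] = 4" for a b c d :: "'g \<times> ('g \<Rightarrow> 'k)" by simp
    then have wick4: "wick symp_form \<xi> 4 [a, b, c, d] = \<xi> a * \<xi> b * (\<xi> c * \<xi> d)" for a b c d
      using wick_length[of symp_form \<xi> "[a, b, c, d]"] by (simp only: list.map prod_list.Cons prod_list.Nil mult_1_right mult.assoc)
    have "wick_ext symp_form \<xi> 4 (nu_word Z x * nu_word Z y) =
        scal ((\<Sum>z\<in>Z. \<xi> (vec (br x z)) * \<xi> (0, ?d z)) * (\<Sum>z\<in>Z. \<xi> (vec (br y z)) * \<xi> (0, ?d z)))"
      by (simp add: nu_word_def wick_ext_def sum_product lext_sum scal_sum wick4 flip: wd_append)
    then show ?thesis by (simp add: ev)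
  qed
  have "wick_ext symp_form \<xi> 4 (nu_ext Z (\<Sum>w\<in>X. wd [w, B_dual_basis B \<kk> X w])) =
      (\<Sum>w\<in>X. wick_ext symp_form \<xi> 4 (nu_word Z w * nu_word Z (B_dual_basis B \<kk> X w)))"
    by (simp add: nu_ext_def wick_ext_def lext_sum)
  also have "\<dots> = scal (\<Sum>w\<in>X. B (br u v) w * B (br u v) (B_dual_basis B \<kk> X w))"
    by (simp add: W scal_sum)
  finally show ?thesis
    using sum_B_dual_basis[OF X br_pp[OF u v]] by (simp add: \<xi>_def)
qed

end

theorem proposition3p7:
  fixes scale :: "'k::field_char_0 \<Rightarrow> 'g::ab_group_add \<Rightarrow> 'g"
    and br :: "'g \<Rightarrow> 'g \<Rightarrow> 'g" and B :: "'g \<Rightarrow> 'g \<Rightarrow> 'k"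
    and \<kk> \<pp> X Z :: "'g set"
  assumes "graded_quadratic_lie_algebra scale br B \<kk> \<pp>"
    and "is_basis_of scale X \<kk>"
    and "is_basis_of scale Z \<pp>"
    and "{B u v | u v. u \<in> bracket_space scale br \<pp> \<pp> \<and> v \<in> bracket_space scale br \<pp> \<pp>} \<noteq> {0}"
  shows "sym_component (symp_scale scale) (symp_space scale \<pp>) 4
           (eta (symp_scale scale) (symp_space scale \<pp>) symp_form
             (nu scale br \<kk> \<pp> Z (casimir scale br B \<kk> X)))
         \<noteq> \<zero>\<^bsub>sym_alg (symp_scale scale) (symp_space scale \<pp>)\<^esub>"
proof -
  interpret graded_quadratic_lie_algebra scale br B \<kk> \<pp> by fact
  note X = assms(2) and Z = assms(3)
  obtain u v where u: "u \<in> \<pp>" and v: "v \<in> \<pp>" and nz: "B (br u v) (br u v) \<noteq> 0"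
    using exists_sectional_nonzero[OF assms(1,4)] .
  let ?f = "\<Sum>w\<in>X. wd [w, B_dual_basis B \<kk> X w] :: 'g word \<Rightarrow>\<^sub>0 'k"
  have f: "?f \<in> free_carrier \<kk>"
    using X span_base B_dual_basis_props(1)[OF X]
    by (intro sum_in_free wd_in_free) (auto simp: is_basis_of_def)
  show ?thesis
    \<comment> \<open>The argument of \<open>eta\<close> becomes the Weyl class of an explicit
      polynomial, on which the functional can be evaluated.\<close>
    unfolding casimir_eq[OF X] nu_quot_cls[OF Z f]
  proof (rule sym_component_eta_nonzero[where \<xi> = "\<lambda>(p, \<alpha>). B u p + \<alpha> v", OF linear_closed_symp_space])
    show "nu_ext Z ?f \<in> free_carrier (symp_space scale \<pp>)" by (rule nu_ext_in_free[OF Z f])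
    show "wick_ext symp_form (\<lambda>(p, \<alpha>). B u p + \<alpha> v) 4 (nu_ext Z ?f) \<noteq> 0"
      unfolding wick_ext_nu_casimir[OF X Z u v] using nz by (metis lookup_single_eq lookup_zero)
  qed (use v in \<open>auto simp: symp_form_def symp_space_def symp_scale_def dual_space_def B_right.add B_right.scale algebra_simps\<close>)
qed

end
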